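(* Let $q$ be a prime power with $q \equiv 1 \pmod{20}$, let $\alpha$ be a primitive element of $\mathbb{F}_q$, let $h = \alpha^{\frac{q-1}{5}}$, and let $\chi$ be the quadratic character of $\mathbb{F}_q$. Then the Paley graph $P(q)$ is $G(5,2)$-partitionable if and only if $\chi(1+h) = -1$.
   Context: $\mathbb{F}_q$ is the finite field with $q$ elements and $\mathbb{F}_q^{\times}$ its multiplicative group. The quadratic character is given, for $a \in \mathbb{F}_q^{\times}$, by $\chi(a) = 1$ if $a$ is a nonzero square in $\mathbb{F}_q$ and $\chi(a) = -1$ otherwise. A primitive element of $\mathbb{F}_q$ is a generator of $\mathbb{F}_q^{\times}$. For a prime power $q \equiv 1 \pmod 4$, the Paley graph $P(q)$ is the simple undirected graph with vertex set $\mathbb{F}_q$ in which two distinct vertices $x_1, x_2$ are adjacent if and only if $\chi(x_1 - x_2) = 1$. Let $q \equiv 1 \pmod{20}$ and let $H = \{1, h, h^2, h^3, h^4\}$, the subgroup of order $5$ of $\mathbb{F}_q^{\times}$. Since $\chi(h) = 1$, every coset of $H$ in $\mathbb{F}_q^{\times}$ consists either entirely of squares (such a coset is called a residue orbit) or entirely of non-squares (a non-residue orbit). The graph $P(q)$ is called $G(5,2)$-partitionable if the residue orbits can be paired with the non-residue orbits, i.e. there is a bijection $\phi$ from the set of residue orbits to the set of non-residue orbits, such that for every residue orbit $R$ the subgraph of $P(q)$ induced on $R \cup \phi(R)$ is isomorphic to the Petersen graph. (The only vertex not included in these subgraphs is $0$.) *)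

theory Defs
  imports "HOL-Library.Cardinality" "HOL-Number_Theory.Number_Theory" "Graph_Theory.Graph_Theory"
begin

text \<open>
  The field with q elements is a type of class \<^class>\<open>finite_field\<close> with
  \<^term>\<open>CARD('a) = q\<close>.  Simple undirected graphs are symmetric, loop-free digraphs
  without parallel arcs (locale \<^locale>\<open>pair_graph\<close>): an edge is a pair of opposite arcs.
\<close>

definition primitive_element :: "'a::field \<Rightarrow> bool" where
  "primitive_element a \<longleftrightarrow> a \<noteq> 0 \<and> range (\<lambda>k::int. a powi k) = UNIV - {0}"

text \<open>The value at 0 is only a convention.\<close>

definition quadratic_char :: "'a::field \<Rightarrow> int" where
  "quadratic_char a = (if a = 0 then 0 else if \<exists>b. a = b\<^sup>2 then 1 else -1)"

definition paley_graph :: "'a::finite_field pair_pre_digraph" where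
  "paley_graph =
     \<lparr> pverts = UNIV, parcs = {(x, y). x \<noteq> y \<and> quadratic_char (x - y) = 1} \<rparr>"

text \<open>
  The generalized Petersen graph G(n,k): outer vertices \<^term>\<open>Inl i\<close>, inner vertices
  \<^term>\<open>Inr i\<close>, indices modulo n.
\<close>

definition generalized_petersen :: "nat \<Rightarrow> nat \<Rightarrow> (nat + nat) pair_pre_digraph" where
  "generalized_petersen n k =
     (let E = (\<Union>i<n. {(Inl i, Inl ((i + 1) mod n)),
                       (Inl i, Inr i),
                       (Inr i, Inr ((i + k) mod n))})
      in \<lparr> pverts = Inl ` {..<n} \<union> Inr ` {..<n}, parcs = E \<union> E\<inverse> \<rparr>)"

definition petersen_graph :: "(nat + nat) pair_pre_digraph" where
  "petersen_graph = generalized_petersen 5 2"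

definition mult_cosets :: "'a::field set \<Rightarrow> 'a set set" where
  "mult_cosets H = {(*) a ` H | a. a \<noteq> 0}"

definition residue_orbits :: "'a::field set \<Rightarrow> 'a set set" where
  "residue_orbits H = {R \<in> mult_cosets H. \<forall>x\<in>R. quadratic_char x = 1}"

definition nonresidue_orbits :: "'a::field set \<Rightarrow> 'a set set" where
  "nonresidue_orbits H = {N \<in> mult_cosets H. \<forall>x\<in>N. quadratic_char x = -1}"

definition G52_partitionable :: "'a::finite_field set \<Rightarrow> bool" where
  "G52_partitionable H \<longleftrightarrow>
     (\<exists>\<phi>. bij_betw \<phi> (residue_orbits H) (nonresidue_orbits H) \<and>
        (\<forall>R\<in>residue_orbits H.
           digraph_iso (with_proj paley_graph \<restriction> (R \<union> \<phi> R)) (with_proj petersen_graph)))"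

text \<open>Both digraphs are simple undirected graphs; for the Paley graph, symmetry
  needs the hypothesis q = 1 (mod 4).\<close>

lemma pair_graph_petersen: "pair_graph petersen_graph"
proof
  have [simp]: "(i + 1) mod 5 \<noteq> i" "(i + 2) mod 5 \<noteq> i"
    "Suc i mod 5 \<noteq> i" "Suc (Suc i) mod 5 \<noteq> i"
    "i \<noteq> Suc i mod 5" "i \<noteq> Suc (Suc i) mod 5" "i \<noteq> (i + 2) mod 5" for i :: nat
    by presburger+
  fix e assume e: "e \<in> parcs petersen_graph"
  then show "fst e \<in> pverts petersen_graph" "snd e \<in> pverts petersen_graph"
    by (auto simp: petersen_graph_def generalized_petersen_def Let_def)
  from e show "fst e \<noteq> snd e"
    by (auto simp: petersen_graph_def generalized_petersen_def Let_def)
next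
  show "finite (pverts petersen_graph)" "finite (parcs petersen_graph)"
    by (auto simp: petersen_graph_def generalized_petersen_def Let_def)
  show "symmetric (with_proj petersen_graph)"
    by (simp add: petersen_graph_def generalized_petersen_def Let_def symmetric_def sym_Un_converse)
qed

lemma pair_graph_paley:
  assumes "primitive_element (a::'a::finite_field)" and "[CARD('a) = 1] (mod 4)"
  shows "pair_graph (paley_graph :: 'a pair_pre_digraph)"
proof -
  let ?q = "CARD('a)"
  have q: "?q > 1" using card_mono[of "UNIV :: 'a set" "{0, 1}"] by simp
  define m where "m = (?q - 1) div 4"
  have m: "?q - 1 = 4 * m" "m > 0"
  proof -
    have "?q mod 4 = 1" using assms(2) by (simp add: cong_def)
    then show "?q - 1 = 4 * m" unfolding m_def by presburger
    then show "m > 0" using q by auto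
  qed
  have a0: "a \<noteq> 0" using assms by (simp add: primitive_element_def)
  define b where "b = a ^ m"
  have "b ^ 4 * a = a ^ (4 * m + 1)"
    by (simp add: b_def mult.commute flip: power_mult)
  also have "4 * m + 1 = ?q" using m q by simp
  finally have "b ^ 4 * a = a" by (simp add: finite_field_power_card_eq_same)
  then have b4: "b ^ 4 = 1" using a0 by simp
  have "b\<^sup>2 \<noteq> 1"
  proof
    assume "b\<^sup>2 = 1"
    then have p: "a ^ (2 * m) = 1" using power_mult[of a m 2] by (simp add: b_def mult.commute)
    have "UNIV - {0} \<subseteq> (\<lambda>i. a ^ i) ` {..<2 * m}"
    proof
      fix x :: 'a assume "x \<in> UNIV - {0}"
      then have "x \<in> range (\<lambda>k::int. a powi k)"
        using assms(1) by (simp add: primitive_element_def)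
      then obtain k :: int where k: "x = a powi k" by blast
      define r where "r = k mod int (2 * m)"
      have r: "0 \<le> r" "r < int (2 * m)" using m(2) by (simp_all add: r_def)
      have "k = int (2 * m) * (k div int (2 * m)) + r" by (simp add: r_def)
      then have "a powi k = a powi (int (2 * m) * (k div int (2 * m))) * a powi r"
        using a0 power_int_add[of a "int (2 * m) * (k div int (2 * m))" r] by simp
      also have "a powi (int (2 * m) * (k div int (2 * m))) = 1"
        unfolding power_int_mult power_int_of_nat p by simp
      also have "1 * a powi r = a ^ nat r" using r by (simp add: power_int_def)
      finally have "x = a ^ nat r" using k by simp
      moreover have "nat r < 2 * m" using r by linarith
      ultimately show "x \<in> (\<lambda>i. a ^ i) ` {..<2 * m}" by blast
    qed
    then have "card (UNIV - {0::'a}) \<le> card ((\<lambda>i. a ^ i) ` {..<2 * m})"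
      by (intro card_mono) auto
    also have "\<dots> \<le> 2 * m" using card_image_le[of "{..<2 * m}"] by simp
    finally have "?q - 1 \<le> 2 * m" by (simp add: card_Diff_singleton)
    then show False using m by simp
  qed
  moreover have "(b\<^sup>2 - 1) * (b\<^sup>2 + 1) = 0" using b4 by (simp add: algebra_simps flip: power_add)
  ultimately have b: "b\<^sup>2 = -1" by (simp add: eq_neg_iff_add_eq_0)
  have "quadratic_char (y - x) = 1" if xy: "quadratic_char (x - y) = 1" for x y :: 'a
  proof -
    obtain c where c: "x \<noteq> y" "x - y = c\<^sup>2" using xy by (auto simp: quadratic_char_def split: if_splits)
    have "y - x = (b * c)\<^sup>2" using b c(2) by (simp add: power_mult_distrib algebra_simps)
    then show ?thesis using c(1) by (auto simp: quadratic_char_def)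
  qed
  then show ?thesis
    unfolding paley_graph_def by unfold_locales (auto simp: symmetric_def sym_def)
qed

end

theory Submission
  imports Defs "HOL-Computational_Algebra.Polynomial" "HOL-Number_Theory.Mod_Exp"
begin

text \<open>
  Write \<open>\<chi>\<close> for the quadratic character.  Multiplication by a nonzero square, in particular by
  \<open>h = (h ^ 3)\<^sup>2\<close>, is an automorphism of the Paley graph, so the graph induced on a residue orbit \<open>R\<close> and a nonresidue orbit \<open>N\<close> has a
  rotation of order five, and everything is determined by a few character values.  Within an
  orbit, distance one on the five-cycle is governed by \<open>\<chi> (1 - h)\<close> and distance two
  by \<open>\<chi> (1 - h ^ 2) = \<chi> (1 - h) * \<chi> (1 + h)\<close>, with opposite signs for \<open>R\<close> and \<open>N\<close>.  If
  \<open>\<chi> (1 + h) = 1\<close>, one of the orbits is a complete graph, which contradicts the Petersen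
  graph being free of triangles.  If \<open>\<chi> (1 + h) = -1\<close>, one is a pentagon and the other a pentagram,
  and we get a Petersen graph as soon as the edges between them form a perfect
  matching.  For \<open>N = t * R\<close> this means that exactly one of the five numbers \<open>1 - t * h ^ j\<close> is a
  square.  A single nonresidue \<open>t\<close> with this property gives the pairing of all orbits.

  The existence of \<open>t\<close> is the main difficulty (\<open>exists_good_nonresidue\<close>).  No fixed
  expression in \<open>h\<close> can serve for all \<open>q\<close>: the quadratic residue symbol modulo the
  prime above 5 of the fifth cyclotomic field also satisfies \<open>\<chi> (1 + h) = -1\<close>, but for it all
  five values agree for every nonresidue \<open>t\<close>, and by Chebotarev's theorem there are \<open>q\<close> for which
  \<open>\<chi>\<close> coincides with this symbol on any given finite set of elements.  Instead, \<open>t\<close> is counted.  First,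
  \<open>\<chi> (1 + h) = -1\<close> forces \<open>q\<close> to be an odd power of a prime \<open>p\<close> that is 1 modulo 20
  (\<open>char_of_nonsquare_one_plus_fifth_root\<close>), and then \<open>t\<close> can be sought in the field of \<open>p\<close> elements.

  Let \<open>S\<close> be the sum of the five signs \<open>\<chi> (1 - t * h ^ j)\<close>.  Replacing \<open>t\<close> by \<open>1 / t\<close> changes the
  sign of \<open>S\<close>, so it is enough to find \<open>\<bar>S\<bar> = 3\<close>.  The indicator of this event is, up to a constant,
  the sum over the orbit of \<open>t\<close> of a polynomial in the signs that depends on \<open>u = t + 1 / t\<close>
  alone (\<open>weight_eq_trace_weight\<close>).  The sum over all nonresidues \<open>t\<close> thus turns into a sum over \<open>u\<close> of
  products of the four functions \<open>\<chi> (u - a)\<close> with \<open>a\<close> equal to 2, -2, \<open>h + h ^ 4\<close> or \<open>h ^ 2 + h ^ 3\<close>,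
  with main term about \<open>p\<close> and an error consisting of eleven character sums of cubic polynomials.
  Stepanov's method, applied with multiplicities that do not grow with \<open>p\<close>, bounds each of
  them by about \<open>p / 12\<close> for \<open>p > 1707\<close> (\<open>stepanov_bound\<close>, \<open>four_point_sum_pos\<close>).  The thirty smaller
  primes are settled by explicit values of \<open>t\<close>.
\<close>

section \<open>Linear dependence over a finite field\<close>

text \<open>Over a finite field, linear dependence is a pigeonhole argument: there are more
  coefficient vectors than values of the system, so two of them have the same value.\<close>

lemma homogeneous_system_nontrivial_solution:
  fixes A :: "'i \<Rightarrow> 'c \<Rightarrow> 'a::finite_field"
  assumes fin: "finite I" "finite C" and more: "card C < card I"
  shows "\<exists>x. (\<exists>i\<in>I. x i \<noteq> 0) \<and> (\<forall>c\<in>C. (\<Sum>i\<in>I. x i * A i c) = 0)"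
proof -
  define F where "F x = (\<lambda>c\<in>C. \<Sum>i\<in>I. x i * A i c)" for x :: "'i \<Rightarrow> 'a"
  have q: "CARD('a) > 1"
    using card_mono[of "UNIV :: 'a set" "{0, 1}"] by simp
  have "card (PiE C (\<lambda>_. UNIV :: 'a set)) < card (PiE I (\<lambda>_. UNIV :: 'a set))"
    using q more fin by (simp add: card_PiE power_strict_increasing)
  moreover have "F ` PiE I (\<lambda>_. UNIV) \<subseteq> PiE C (\<lambda>_. UNIV)"
    by (auto simp: F_def)
  ultimately have "\<not> inj_on F (PiE I (\<lambda>_. UNIV))"
    using fin by (intro pigeonhole) (meson card_mono finite_PiE finite leD le_trans not_less)
  then obtain x y where xy: "x \<in> PiE I (\<lambda>_. UNIV)" "y \<in> PiE I (\<lambda>_. UNIV)" "x \<noteq> y" "F x = F y"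
    by (auto simp: inj_on_def)
  have "\<exists>i\<in>I. x i - y i \<noteq> 0"
    using xy(1-3) by (metis PiE_ext eq_iff_diff_eq_0)
  moreover have "(\<Sum>i\<in>I. (x i - y i) * A i c) = 0" if "c \<in> C" for c
    using fun_cong[OF xy(4), of c] that by (simp add: F_def left_diff_distrib sum_subtractf)
  ultimately show ?thesis
    by (intro exI[of _ "\<lambda>i. x i - y i"]) auto
qed

text \<open>The nonzero term of largest degree cannot be cancelled by the others.\<close>

lemma combination_of_distinct_degrees_nonzero:
  fixes B :: "'i \<Rightarrow> 'a::idom poly"
  assumes fin: "finite I" and inj: "inj_on (\<lambda>i. degree (B i)) I"
    and B: "\<And>i. i \<in> I \<Longrightarrow> B i \<noteq> 0" and x: "\<exists>i\<in>I. x i \<noteq> 0"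
  shows "(\<Sum>i\<in>I. smult (x i) (B i)) \<noteq> 0"
proof -
  define S where "S = {i \<in> I. x i \<noteq> 0}"
  have S: "finite S" "S \<noteq> {}" using fin x by (auto simp: S_def)
  obtain k where k: "k \<in> S" "\<And>i. i \<in> S \<Longrightarrow> degree (B i) \<le> degree (B k)"
  proof -
    have "Max ((\<lambda>i. degree (B i)) ` S) \<in> (\<lambda>i. degree (B i)) ` S"
      using S by (intro Max_in) auto
    then obtain k where "k \<in> S" "Max ((\<lambda>i. degree (B i)) ` S) = degree (B k)" by blast
    then show ?thesis using that[of k] S(1) by (metis Max_ge finite_imageI imageI)
  qed
  have "x i * coeff (B i) (degree (B k)) = 0" if "i \<in> I - {k}" for i
  proof (cases "x i = 0")
    case False
    then have "degree (B i) \<noteq> degree (B k)" "i \<in> S"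
      using that k(1) inj by (auto simp: S_def inj_on_def)
    then have "degree (B i) < degree (B k)" using k(2) by force
    then show ?thesis by (simp add: coeff_eq_0)
  qed auto
  then have "(\<Sum>i\<in>I - {k}. x i * coeff (B i) (degree (B k))) = 0"
    by (intro sum.neutral) auto
  then have "coeff (\<Sum>i\<in>I. smult (x i) (B i)) (degree (B k)) = x k * lead_coeff (B k)"
    using k(1) fin by (simp add: coeff_sum S_def sum.remove[of I k])
  also have "\<dots> \<noteq> 0" using k(1) B by (auto simp: S_def)
  finally show ?thesis by auto
qed

section \<open>Stepanov's method for cubic polynomials\<close>

text \<open>The \<open>k\<close>-th derivative of \<open>w * f ^ n\<close> is \<open>f ^ n\<close> times a rational function with
  denominator \<open>f ^ k\<close>; this is its numerator.  The exponent \<open>n\<close> enters only as a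
  coefficient, so the degree bound does not depend on \<open>n\<close>.\<close>

primrec deriv_numerator :: "'a::idom poly \<Rightarrow> nat \<Rightarrow> 'a poly \<Rightarrow> nat \<Rightarrow> 'a poly" where
  "deriv_numerator f n w 0 = w"
| "deriv_numerator f n w (Suc k) =
     f * pderiv (deriv_numerator f n w k)
     + smult (of_nat n - of_nat k) (pderiv f * deriv_numerator f n w k)"

lemma pderiv_power_times: "f * pderiv (f ^ n) = smult (of_nat n) (pderiv f * f ^ n)"
  for f :: "'a::idom poly"
  by (cases n) (simp_all add: pderiv_power_Suc mult_ac del: power_Suc, simp add: mult_ac)

lemma deriv_numerator_correct:
  "f ^ k * (pderiv ^^ k) (w * f ^ n) = deriv_numerator f n w k * f ^ n"
proof (induction k)
  case (Suc k)
  let ?D = "(pderiv ^^ k) (w * f ^ n)" and ?W = "deriv_numerator f n w k"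
  have "f * pderiv (f ^ k * ?D) = f * pderiv (?W * f ^ n)"
    using Suc by simp
  then have "f * f ^ k * pderiv ?D + (f * pderiv (f ^ k)) * ?D
      = f * pderiv ?W * f ^ n + ?W * (f * pderiv (f ^ n))"
    by (simp add: pderiv_mult algebra_simps)
  then have "f * f ^ k * pderiv ?D + smult (of_nat k) (pderiv f * (f ^ k * ?D))
      = f * pderiv ?W * f ^ n + smult (of_nat n) (pderiv f * ?W * f ^ n)"
    by (simp add: pderiv_power_times mult_ac)
  then show ?case
    by (simp add: Suc smult_diff_left algebra_simps)
qed simp

lemma degree_pderiv_le: "degree (pderiv f) \<le> degree f - 1"
  by (rule degree_le) (auto simp: coeff_pderiv coeff_eq_0)

text \<open>Each differentiation costs two degrees: one derivative is lost and one factor \<open>f\<close> of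
  degree three is gained.\<close>

lemma degree_deriv_numerator:
  assumes "degree f \<le> 3"
  shows "degree (deriv_numerator f n w k) \<le> degree w + 2 * k"
proof (induction k)
  case (Suc k)
  let ?W = "deriv_numerator f n w k"
  have df: "degree (pderiv f) \<le> 2"
    using degree_pderiv_le[of f] assms by linarith
  have "degree (f * pderiv ?W) \<le> degree w + 2 * Suc k"
  proof (cases "degree ?W = 0")
    case True
    then have "pderiv ?W = 0" by (metis degree_eq_zeroE pderiv_singleton)
    then show ?thesis by simp
  next
    case False
    have "degree (f * pderiv ?W) \<le> 3 + (degree ?W - 1)"
      using degree_mult_le[of f "pderiv ?W"] degree_pderiv_le[of ?W] assms by linarith
    then show ?thesis using False Suc by simp
  qed
  moreover have "degree (smult c (pderiv f * ?W)) \<le> degree w + 2 * Suc k" for c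
    by (rule order.trans[OF degree_smult_le order.trans[OF degree_mult_le]]) (use df Suc in simp)
  ultimately show ?case
    unfolding deriv_numerator.simps by (rule degree_add_le)
qed simp

text \<open>In characteristic \<open>p\<close>, the powers of \<open>X ^ p\<close> are constants for differentiation.\<close>

lemma higher_pderiv_char_power:
  fixes w :: "'a::idom poly"
  shows "(pderiv ^^ k) (monom 1 (j * CHAR('a)) * w) = monom 1 (j * CHAR('a)) * (pderiv ^^ k) w"
  by (induction k) (simp_all add: pderiv_mult pderiv_monom)

lemma higher_pderiv_at_multiple_root:
  fixes Q :: "'a::idom poly"
  shows "poly ((pderiv ^^ e) ([:-a, 1:] ^ e * Q)) a = of_nat (fact e) * poly Q a"
proof -
  have "\<exists>R. (pderiv ^^ k) (L ^ (k + n) * Q)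
      = L ^ n * (smult (pochhammer (of_nat (Suc n)) k) Q + L * R)"
    if L: "pderiv L = 1" for k n and L :: "'a poly"
  proof (induction k arbitrary: n)
    case 0
    show ?case by (intro exI[of _ 0]) simp
  next
    case (Suc k)
    from Suc.IH[of "Suc n"] obtain R where R: "(pderiv ^^ k) (L ^ (k + Suc n) * Q)
      = L ^ Suc n * (smult (pochhammer (of_nat (Suc (Suc n))) k) Q + L * R)"
      by blast
    let ?c = "pochhammer (of_nat (Suc (Suc n))) k :: 'a" and ?d = "of_nat (Suc n) :: 'a"
    have D: "pderiv (L ^ Suc n * A) = L ^ n * (smult ?d A + L * pderiv A)" for A
      by (simp add: pderiv_mult pderiv_power_Suc L del: of_nat_Suc power_Suc)
         (simp add: algebra_simps del: of_nat_Suc)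
    have "pderiv (L ^ Suc n * (smult ?c Q + L * R))
      = L ^ n * (smult ?d (smult ?c Q + L * R) + L * (smult ?c (pderiv Q) + L * pderiv R + R))"
      unfolding D by (simp add: pderiv_mult pderiv_add pderiv_smult L)
    also have "\<dots> = L ^ n * (smult (pochhammer ?d (Suc k)) Q
        + L * (smult ?d R + (smult ?c (pderiv Q) + L * pderiv R + R)))"
      by (simp add: pochhammer_rec smult_add_right add_ac del: of_nat_Suc)
         (simp add: algebra_simps)
    finally show ?case
      using R by (auto simp del: power_Suc)
  qed
  from this[of "[:-a, 1:]" e 0] obtain R where "(pderiv ^^ e) ([:-a, 1:] ^ e * Q)
      = smult (pochhammer 1 e) Q + [:-a, 1:] * R"
    by (auto simp: pderiv_pCons)
  moreover have "pochhammer (1 :: 'a) e = of_nat (fact e)"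
    by (metis of_nat_1 pochhammer_fact pochhammer_of_nat)
  ultimately show ?thesis by simp
qed

text \<open>If the multiplicity \<open>e\<close> of the root were smaller than \<open>M\<close>, the \<open>e\<close>-th derivative would
  be \<open>e!\<close> times a nonzero number, and \<open>e!\<close> is invertible because \<open>e < p\<close>.\<close>

lemma order_ge_of_vanishing_derivatives:
  fixes G :: "'a::idom_prime_char poly"
  assumes G: "G \<noteq> 0" and M: "M \<le> CHAR('a)"
    and van: "\<And>k. k < M \<Longrightarrow> poly ((pderiv ^^ k) G) a = 0"
  shows "M \<le> order a G"
proof (rule ccontr)
  assume "\<not> M \<le> order a G"
  then have e: "order a G < M" by simp
  obtain Q where Q: "G = [:-a, 1:] ^ order a G * Q" "\<not> [:-a, 1:] dvd Q"
    using order_decomp[OF G] by blast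
  have "poly ((pderiv ^^ order a G) G) a = of_nat (fact (order a G)) * poly Q a"
    using higher_pderiv_at_multiple_root[of "order a G" a Q] Q(1) by simp
  moreover have "poly Q a \<noteq> 0" using Q(2) by (simp add: poly_eq_0_iff_dvd)
  moreover have "of_nat (fact (order a G)) \<noteq> (0 :: 'a)"
  proof
    assume "of_nat (fact (order a G)) = (0 :: 'a)"
    then have "CHAR('a) dvd fact (order a G)"
      by (simp add: of_nat_eq_0_iff_char_dvd)
    then show False using e M by (simp add: prime_dvd_fact_iff)
  qed
  ultimately show False using van[OF e] by simp
qed

lemma pderiv_sum: "pderiv (\<Sum>i\<in>I. B i) = (\<Sum>i\<in>I. pderiv (B i))"
  by (induction I rule: infinite_finite_induct) (simp_all add: pderiv_add)

lemma higher_pderiv_combination: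
  "(pderiv ^^ k) (\<Sum>i\<in>I. smult (x i) (B i)) = (\<Sum>i\<in>I. smult (x i) ((pderiv ^^ k) (B i)))"
  for B :: "'i \<Rightarrow> 'a::idom poly"
  by (induction k) (simp_all add: pderiv_sum pderiv_smult)

lemma div_mod_unique:
  fixes a b r s p :: nat
  assumes "a * p + r = b * p + s" "r < p" "s < p"
  shows "a = b \<and> r = s"
proof -
  have "(a * p + r) div p = a" "(b * p + s) div p = b" using assms(2,3) by auto
  then show ?thesis using assms(1) by auto
qed

text \<open>Stepanov's method.  Put \<open>g = f ^ m\<close>, so that \<open>g\<close> takes the value \<open>\<epsilon>\<close> at every point
  that is counted.  The auxiliary polynomial is a combination of the products
  \<open>X ^ (j * p) * X ^ i * g ^ e\<close> with \<open>e\<close> in \<open>{0, 1}\<close>.  Multiplied by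
  \<open>f ^ k\<close>, its \<open>k\<close>-th derivative agrees at the counted points with a polynomial of degree less than \<open>m + J + 2 * k\<close>, because there \<open>X ^ p\<close> acts like \<open>X\<close>
  and \<open>g\<close> like \<open>\<epsilon>\<close>.  The inequality \<open>more\<close> says that there are more coefficients than
  conditions for these polynomials to vanish for all \<open>k < M\<close>.  The auxiliary polynomial is
  then nonzero, as its building blocks have distinct degrees, has degree less than
  \<open>J * p\<close>, and vanishes \<open>M\<close>-fold at all counted points.\<close>

lemma stepanov_bound:
  fixes f :: "'a::finite_field poly" and \<epsilon> :: 'a
  defines "p \<equiv> CHAR('a)"
  defines "m \<equiv> (p - 1) div 2"
  assumes deg: "degree f = 3" and odd: "odd p" and m: "m \<ge> 1"
    and J: "J \<ge> 1" and M: "M \<le> p"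
    and more: "M * (m + J) + M * (M - 1) < J * (m - 1) + (J - 1) * (m + 2)"
    and \<epsilon>: "\<epsilon> \<noteq> 0"
  shows "M * card {a. a ^ p = a \<and> poly f a ^ m = \<epsilon>} \<le> J * p - 1"
proof -
  have p: "p = 2 * m + 1" using odd by (auto simp: m_def elim: oddE)
  have f0: "f \<noteq> 0" using deg by auto
  \<comment> \<open>The ranges of \<open>i\<close> are as large as possible with distinct degrees: since
    \<open>3 * m = p + (m - 1)\<close>, the degrees are modulo \<open>p\<close> in \<open>{0..m - 2}\<close> for \<open>e = 0\<close>
    and in \<open>{m - 1..2 * m}\<close> for \<open>e = 1\<close>.  As \<open>g\<close> adds at least \<open>p\<close> to the degree,
    the range of \<open>j\<close> is shorter by one for \<open>e = 1\<close>.\<close>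
  define I :: "(nat \<times> nat \<times> nat) set"
    where "I = {0} \<times> {..<J} \<times> {..<m - 1} \<union> {1} \<times> {..<J - 1} \<times> {..<m + 2}"
  define B where "B = (\<lambda>(e, j, i). monom 1 (j * p) * (monom 1 i * f ^ (m * e)))"
  define W where "W = (\<lambda>k (e, j, i). monom 1 j * deriv_numerator f (m * e) (monom 1 i) k)"
  define C :: "(nat \<times> nat) set" where "C = (SIGMA k:{..<M}. {..<m + J + 2 * k})"
  have finI: "finite I" and finC: "finite C" by (simp_all add: I_def C_def)
  have cardI: "card I = J * (m - 1) + (J - 1) * (m + 2)"
    unfolding I_def by (subst card_Un_disjoint) (auto simp: card_cartesian_product)
  have cardC: "card C = M * (m + J) + M * (M - 1)"
  proof -
    have "(\<Sum>k<M. m + J + 2 * k) = M * (m + J) + M * (M - 1)"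
    proof (induction M)
      case (Suc M) then show ?case by (cases M) (simp_all add: algebra_simps)
    qed simp
    then show ?thesis by (simp add: C_def card_SigmaI)
  qed
  have "card C < card I" using more by (simp only: cardI cardC)
  from homogeneous_system_nontrivial_solution[OF finI finC this,
      of "\<lambda>i c. \<epsilon> ^ fst i * coeff (W (fst c) i) (snd c)"]
  obtain x where x: "\<exists>i\<in>I. x i \<noteq> 0"
    and sys: "\<forall>c\<in>C. (\<Sum>i\<in>I. x i * (\<epsilon> ^ fst i * coeff (W (fst c) i) (snd c))) = 0"
    by blast
  define G where "G = (\<Sum>i\<in>I. smult (x i) (B i))"
  define T where "T k = (\<Sum>i\<in>I. smult (x i) (smult (\<epsilon> ^ fst i) (W k i)))" for k

  have degB: "degree (B (e, j, i)) = (j + e) * p + (i + e * (m - 1))"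
    and rem: "i + e * (m - 1) < p" and quot: "j + e \<le> J - 1" if "(e, j, i) \<in> I" for e j i
  proof -
    from that have e: "e = 0 \<and> j < J \<and> i < m - 1 \<or> e = 1 \<and> j < J - 1 \<and> i < m + 2"
      by (auto simp: I_def)
    have "degree (B (e, j, i)) = j * p + (i + 3 * (m * e))"
      using f0 by (simp add: B_def degree_mult_eq degree_monom_eq degree_power_eq deg monom_eq_0_iff)
    also have "\<dots> = (j + e) * p + (i + e * (m - 1))"
    proof -
      have "3 * m = p + (m - 1)" using m p by linarith
      then show ?thesis using e by (auto simp: algebra_simps)
    qed
    finally show "degree (B (e, j, i)) = (j + e) * p + (i + e * (m - 1))" .
    show "i + e * (m - 1) < p" "j + e \<le> J - 1" using e m p by auto
  qed
  have B0: "B i \<noteq> 0" if "i \<in> I" for i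
    using f0 by (auto simp: B_def monom_eq_0_iff split: prod.splits)
  have inj: "inj_on (\<lambda>i. degree (B i)) I"
  proof (rule inj_onI)
    fix s t assume st: "s \<in> I" "t \<in> I" "degree (B s) = degree (B t)"
    obtain e j i e' j' i' where s: "s = (e, j, i)" and t: "t = (e', j', i')"
      by (metis prod_cases3)
    note * = st[unfolded s t]
    have "j + e = j' + e' \<and> i + e * (m - 1) = i' + e' * (m - 1)"
      using *(3) unfolding degB[OF *(1)] degB[OF *(2)]
      by (rule div_mod_unique) (rule rem[OF *(1)], rule rem[OF *(2)])
    moreover from this have "e = e'"
      using *(1,2) by (auto simp: I_def)
    ultimately show "s = t" by (simp add: s t)
  qed
  have G0: "G \<noteq> 0"
    unfolding G_def using finI inj B0 x by (rule combination_of_distinct_degrees_nonzero)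
  have degG: "degree G \<le> J * p - 1"
    unfolding G_def
  proof (rule degree_sum_le[OF finI], clarify)
    fix e j i assume eji: "(e, j, i) \<in> I"
    have "degree (B (e, j, i)) \<le> (J - 1) * p + (p - 1)"
      using degB[OF eji] rem[OF eji] mult_le_mono1[OF quot[OF eji], of p] by linarith
    also have "\<dots> = J * p - 1" using J p by (cases J) auto
    finally show "degree (smult (x (e, j, i)) (B (e, j, i))) \<le> J * p - 1"
      using degree_smult_le le_trans by blast
  qed

  have T0: "T k = 0" if k: "k < M" for k
  proof (rule poly_eqI)
    fix n
    show "coeff (T k) n = coeff 0 n"
    proof (cases "n < m + J + 2 * k")
      case True
      then show ?thesis using bspec[OF sys, of "(k, n)"] k by (simp add: T_def coeff_sum C_def mult.assoc)
    next
      case False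
      have "coeff (W k i) n = 0" if "i \<in> I" for i
      proof -
        obtain e j l where i: "i = (e, j, l)" by (cases i)
        have "degree (W k i) \<le> j + (l + 2 * k)"
          using degree_mult_le[of "monom 1 j :: 'a poly" "deriv_numerator f (m * e) (monom 1 l) k"]
            degree_deriv_numerator[of f "m * e" "monom 1 l" k] deg
          by (simp add: W_def i degree_monom_eq)
        also have "\<dots> < m + J + 2 * k" using that m by (auto simp: I_def i)
        finally show ?thesis using False by (simp add: coeff_eq_0)
      qed
      then show ?thesis by (simp add: T_def coeff_sum)
    qed
  qed

  \<comment> \<open>At a counted point, \<open>f ^ k\<close> times the \<open>k\<close>-th derivative of \<open>G\<close> is the value of \<open>T k\<close>.\<close>
  have van: "poly ((pderiv ^^ k) G) a = 0"
    if k: "k < M" and a: "a ^ p = a" "poly f a ^ m = \<epsilon>" for k a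
  proof -
    have fa: "poly f a \<noteq> 0" using a(2) m \<epsilon> by (auto simp: power_0_left)
    have "poly f a ^ k * poly ((pderiv ^^ k) (B i)) a = poly (smult (\<epsilon> ^ fst i) (W k i)) a" for i
    proof -
      obtain e j l where i: "i = (e, j, l)" by (cases i)
      have "f ^ k * (pderiv ^^ k) (B i) = monom 1 (j * p) * (f ^ k * (pderiv ^^ k) (monom 1 l * f ^ (m * e)))"
        by (simp add: B_def i higher_pderiv_char_power p_def)
      also have "\<dots> = monom 1 (j * p) * (deriv_numerator f (m * e) (monom 1 l) k * f ^ (m * e))"
        by (simp only: deriv_numerator_correct)
      finally have eq: "f ^ k * (pderiv ^^ k) (B i)
        = monom 1 (j * p) * (deriv_numerator f (m * e) (monom 1 l) k * f ^ (m * e))" .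
      have "a ^ (j * p) = a ^ j" using a(1) by (simp add: mult.commute[of j] power_mult)
      moreover have "poly f a ^ (m * e) = \<epsilon> ^ e" using a(2) by (simp add: power_mult)
      ultimately show ?thesis
        using arg_cong[OF eq, of "\<lambda>q. poly q a"] by (simp add: W_def i poly_monom mult_ac)
    qed
    then have "poly f a ^ k * poly ((pderiv ^^ k) G) a = poly (T k) a"
      by (simp add: G_def T_def higher_pderiv_combination poly_sum sum_distrib_left mult_ac)
    then show ?thesis using T0[OF k] fa by simp
  qed

  define Z where "Z = {a. a ^ p = a \<and> poly f a ^ m = \<epsilon>}"
  show ?thesis
  proof (cases "M = 0")
    case False
    have "M * card Z = (\<Sum>a\<in>Z. M)" by simp
    also have "\<dots> \<le> (\<Sum>a\<in>Z. order a G)"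
      using van M G0 unfolding Z_def p_def
      by (intro sum_mono order_ge_of_vanishing_derivatives) auto
    also have "\<dots> \<le> (\<Sum>a | poly G a = 0. order a G)"
      using van[of 0] False by (intro sum_mono2) (auto simp: Z_def)
    also have "\<dots> \<le> degree G" using G0 by (rule sum_order_le_degree)
    finally show ?thesis using degG by (simp add: Z_def)
  qed simp
qed

section \<open>Squares and fifth roots of unity\<close>

lemma card_power_eq_le:
  fixes c :: "'a::idom"
  assumes "n > 0"
  shows "card {x. x ^ n = c} \<le> n"
proof -
  have deg: "degree (monom 1 n - [:c:] :: 'a poly) = n"
    using assms by (subst diff_conv_add_uminus, subst degree_add_eq_left) (auto simp: degree_monom_eq)
  then have "monom 1 n - [:c:] \<noteq> (0 :: 'a poly)" using assms by auto
  from card_poly_roots_bound[OF this] show ?thesis by (simp add: deg poly_monom)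
qed

text \<open>
  Both squaring and the map \<open>x \<mapsto> x ^ m\<close> have small fibres: squaring \<open>2 * m\<close> elements gives at
  least \<open>m\<close> values, and \<open>x ^ m = 1\<close> has at most \<open>m\<close> solutions.  This is Euler's criterion
  for any subgroup of order \<open>2 * m\<close>.
\<close>

lemma squares_eq_half_power_kernel:
  fixes A :: "'a::finite_field set"
  assumes card: "card A = 2 * m" and m: "m > 0" and pow: "\<And>d. d \<in> A \<Longrightarrow> d ^ (2 * m) = 1"
  shows "(\<lambda>d. d\<^sup>2) ` A = {x. x ^ m = 1}"
proof -
  let ?S = "(\<lambda>d. d\<^sup>2) ` A" and ?R = "{x. x ^ m = (1::'a)}"
  have sub: "?S \<subseteq> ?R" using pow by (auto simp flip: power_mult)
  have "A \<subseteq> (\<Union>s\<in>?S. {d. d ^ 2 = s})" by auto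
  then have "card A \<le> card (\<Union>s\<in>?S. {d. d ^ 2 = s})" by (intro card_mono) auto
  also have "\<dots> \<le> (\<Sum>s\<in>?S. card {d. d ^ 2 = s})" by (rule card_UN_le) auto
  also have "\<dots> \<le> (\<Sum>s\<in>?S. 2)" by (intro sum_mono card_power_eq_le) auto
  finally have "m \<le> card ?S" by (simp add: card)
  with card_power_eq_le[OF m] have "card ?R \<le> card ?S" by (rule order.trans)
  then show ?thesis using sub by (intro card_seteq) auto
qed

lemma fifth_root_power_mod:
  fixes h :: "'a::monoid_mult"
  assumes "h ^ 5 = 1" shows "h ^ (k mod 5) = h ^ k"
proof -
  have "h ^ k = (h ^ 5) ^ (k div 5) * h ^ (k mod 5)" by (simp flip: power_mult power_add)
  then show ?thesis by (simp add: assms)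
qed

section \<open>Character sums over the prime field\<close>

definition prime_subfield :: "'a::finite_field set" where
  "prime_subfield = {x. x ^ CHAR('a) = x}"

text \<open>On the prime subfield this is its own quadratic character, by Euler's criterion.  An element
  with value -1 may become a square in the big field; the values outside the prime
  subfield have no meaning.\<close>

definition legendre :: "'a::finite_field \<Rightarrow> int" where
  "legendre x = (if x = 0 then 0 else if x ^ ((CHAR('a) - 1) div 2) = 1 then 1 else -1)"

lemma frobenius_add: "(x + y) ^ CHAR('a) = x ^ CHAR('a) + y ^ CHAR('a)" for x y :: "'a::finite_field"
  by (rule freshmans_dream) auto

lemma zero_in_prime_subfield [simp]: "0 \<in> prime_subfield"
  by (simp add: prime_subfield_def power_0_left)

lemma one_in_prime_subfield [simp]: "1 \<in> prime_subfield"
  by (simp add: prime_subfield_def)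

lemma add_in_prime_subfield [simp]: "x \<in> prime_subfield \<Longrightarrow> y \<in> prime_subfield \<Longrightarrow> x + y \<in> prime_subfield"
  by (simp add: prime_subfield_def frobenius_add)

lemma uminus_in_prime_subfield [simp]:
  assumes "x \<in> prime_subfield" shows "- x \<in> prime_subfield"
proof -
  have "(- x) ^ CHAR('a) + x ^ CHAR('a) = 0"
    using frobenius_add[of "- x" x] by (simp add: power_0_left)
  then show ?thesis using assms by (simp add: prime_subfield_def eq_neg_iff_add_eq_0)
qed

lemma diff_in_prime_subfield [simp]: "x \<in> prime_subfield \<Longrightarrow> y \<in> prime_subfield \<Longrightarrow> x - y \<in> prime_subfield"
  using add_in_prime_subfield[of x "- y"] by simp

lemma mult_in_prime_subfield [simp]: "x \<in> prime_subfield \<Longrightarrow> y \<in> prime_subfield \<Longrightarrow> x * y \<in> prime_subfield"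
  by (simp add: prime_subfield_def power_mult_distrib)

lemma inverse_in_prime_subfield [simp]: "x \<in> prime_subfield \<Longrightarrow> inverse x \<in> prime_subfield"
  by (simp add: prime_subfield_def power_inverse)

lemma divide_in_prime_subfield [simp]: "x \<in> prime_subfield \<Longrightarrow> y \<in> prime_subfield \<Longrightarrow> x / y \<in> prime_subfield"
  by (simp add: divide_inverse)

lemma power_in_prime_subfield [simp]: "x \<in> prime_subfield \<Longrightarrow> x ^ n \<in> prime_subfield"
  by (induction n) auto

lemma of_nat_in_prime_subfield [simp]: "of_nat n \<in> prime_subfield"
  by (induction n) auto

lemma numeral_in_prime_subfield [simp]: "numeral n \<in> prime_subfield"
  by (metis of_nat_in_prime_subfield of_nat_numeral)

text \<open>The multiples of 1 are \<open>p\<close> roots of \<open>X ^ p - X\<close>, which has no more.\<close>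

lemma card_prime_subfield: "card (prime_subfield :: 'a::finite_field set) = CHAR('a)"
proof -
  let ?p = "CHAR('a)"
  have "inj_on (of_nat :: nat \<Rightarrow> 'a) {..<?p}"
  proof (rule linorder_inj_onI)
    fix m n assume *: "m < n" "m \<in> {..<?p}" "n \<in> {..<?p}"
    then have "\<not> ?p dvd n - m" by (auto dest: dvd_imp_le)
    then have "of_nat (n - m) \<noteq> (0::'a)" by (simp add: of_nat_eq_0_iff_char_dvd)
    then show "of_nat m \<noteq> (of_nat n :: 'a)" using * by (auto simp: of_nat_diff)
  qed auto
  then have c: "card (of_nat ` {..<?p} :: 'a set) = ?p" by (simp add: card_image)
  have sub: "(of_nat ` {..<?p} :: 'a set) \<subseteq> prime_subfield" by auto
  have "card (prime_subfield :: 'a set) \<le> ?p"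
  proof -
    have "?p > 1" using prime_gt_1_nat[OF CHAR_prime[where ?'a = 'a]] .
    then have deg: "degree (monom 1 ?p - [:0, 1:] :: 'a poly) = ?p"
      by (subst diff_conv_add_uminus, subst degree_add_eq_left) (auto simp: degree_monom_eq)
    then have "monom 1 ?p - [:0, 1:] \<noteq> (0 :: 'a poly)" using \<open>?p > 1\<close> by auto
    from card_poly_roots_bound[OF this] show ?thesis by (simp add: deg poly_monom prime_subfield_def)
  qed
  moreover have "?p \<le> card (prime_subfield :: 'a set)"
    using card_mono[OF _ sub] c by simp
  ultimately show ?thesis by (rule order.antisym)
qed

text \<open>The type argument selects the field in interpretations.\<close>

locale odd_char =
  fixes ty :: "'a::finite_field itself"
  assumes odd_char: "odd CHAR('a)"
begin

abbreviation K :: "'a set" where "K \<equiv> prime_subfield"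

lemma char_eq: "CHAR('a) = 2 * ((CHAR('a) - 1) div 2) + 1"
  using odd_char by (auto elim: oddE)

lemma half_pos: "(CHAR('a) - 1) div 2 > 0"
  using char_eq CHAR_not_1'[where ?'a = 'a] by (cases "(CHAR('a) - 1) div 2 = 0") auto

lemma two_nonzero [simp]: "(2::'a) \<noteq> 0"
proof
  assume "(2::'a) = 0"
  then have "CHAR('a) dvd 2" by (metis of_nat_eq_0_iff_char_dvd of_nat_numeral)
  then have "CHAR('a) \<le> 2" by (rule dvd_imp_le) simp
  then show False using char_eq half_pos by simp
qed

lemma half_power:
  assumes "x \<in> K" "x \<noteq> 0"
  shows "x ^ ((CHAR('a) - 1) div 2) = 1 \<or> x ^ ((CHAR('a) - 1) div 2) = -1"
proof -
  let ?m = "(CHAR('a) - 1) div 2"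
  have "x ^ (2 * ?m + 1) = x" using assms(1) char_eq by (simp add: prime_subfield_def)
  then have "(x ^ ?m)\<^sup>2 = 1" using assms(2) by (simp add: power_mult mult.commute flip: power_mult)
  then show ?thesis by (simp add: power2_eq_1_iff)
qed

lemma legendre_cases: "x \<in> K \<Longrightarrow> x \<noteq> 0 \<Longrightarrow> legendre x = 1 \<or> legendre x = -1"
  by (auto simp: legendre_def)

lemma one_neq_minus_one: "(1::'a) \<noteq> -1"
  using two_nonzero by (metis add.right_inverse one_add_one)

lemma legendre_eq_iff:
  assumes "x \<in> K"
  shows "legendre x = 0 \<longleftrightarrow> x = 0"
    and "legendre x = 1 \<longleftrightarrow> x ^ ((CHAR('a) - 1) div 2) = 1"
    and "legendre x = -1 \<longleftrightarrow> x ^ ((CHAR('a) - 1) div 2) = -1"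
  using half_power[OF assms] one_neq_minus_one half_pos
  by (auto simp: legendre_def power_0_left)

lemma legendre_mult [simp]:
  assumes "x \<in> K" "y \<in> K"
  shows "legendre (x * y) = legendre x * legendre y"
  using half_power[OF assms(1)] half_power[OF assms(2)] one_neq_minus_one
  by (cases "x = 0"; cases "y = 0") (auto simp: legendre_def power_mult_distrib)

lemma legendre_1 [simp]: "legendre (1::'a) = 1"
  by (simp add: legendre_def)

lemma legendre_square: "x \<in> K \<Longrightarrow> x \<noteq> 0 \<Longrightarrow> legendre (x\<^sup>2) = 1"
  using legendre_cases[of x] by (auto simp: power2_eq_square)

lemma legendre_power: "x \<in> K \<Longrightarrow> legendre (x ^ n) = legendre x ^ n"
  by (induction n) auto

lemma legendre_inverse: "x \<in> K \<Longrightarrow> legendre (inverse x) = legendre x"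
  using legendre_mult[of x "inverse x"] legendre_cases[of x]
  by (cases "x = 0") auto

lemma nonresidue_exists: "\<exists>x\<in>K. legendre x = -1"
proof (rule ccontr)
  let ?m = "(CHAR('a) - 1) div 2"
  assume "\<not> ?thesis"
  then have "K - {0} \<subseteq> {x. x ^ ?m = 1}"
    using legendre_cases legendre_eq_iff(2) by blast
  then have "card (K - {0}) \<le> card {x::'a. x ^ ?m = 1}" by (intro card_mono) auto
  also have "\<dots> \<le> ?m" using half_pos by (rule card_power_eq_le)
  finally show False
    using char_eq half_pos by (simp add: card_Diff_singleton card_prime_subfield)
qed

lemma sum_legendre: "(\<Sum>x\<in>K. legendre x) = 0"
proof -
  obtain n where n: "n \<in> K" "legendre n = -1" using nonresidue_exists by blast
  then have "n \<noteq> 0" by (auto simp: legendre_def)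
  then have "(\<Sum>x\<in>K. legendre x) = (\<Sum>x\<in>K. legendre (n * x))"
    using n(1) by (intro sum.reindex_bij_witness[of _ "\<lambda>x. n * x" "\<lambda>x. x / n"]) auto
  also have "\<dots> = (\<Sum>x\<in>K. - legendre x)" using n by (intro sum.cong) auto
  also have "\<dots> = - (\<Sum>x\<in>K. legendre x)" by (rule sum_negf)
  finally show ?thesis by simp
qed

lemma sum_legendre_shift:
  assumes "c \<in> K" shows "(\<Sum>x\<in>K. legendre (x - c)) = 0"
proof -
  have "(\<Sum>x\<in>K. legendre (x - c)) = (\<Sum>x\<in>K. legendre x)"
    using assms by (intro sum.reindex_bij_witness[of _ "\<lambda>x. x + c" "\<lambda>x. x - c"]) auto
  then show ?thesis by (simp add: sum_legendre)
qed

text \<open>Since \<open>(x - c) * (x - d)\<close> is \<open>(x - c)\<^sup>2\<close> times \<open>1 + (c - d) / (x - c)\<close>, and the second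
  factor takes every value except 1 once, the sum is that over a whole line without the
  value at 1.\<close>

lemma sum_legendre_pair:
  assumes "c \<in> K" "d \<in> K" "c \<noteq> d"
  shows "(\<Sum>x\<in>K. legendre (x - c) * legendre (x - d)) = -1"
proof -
  define e where "e = c - d"
  have e: "e \<in> K" "e \<noteq> 0" using assms by (auto simp: e_def)
  have "(\<Sum>x\<in>K. legendre (x - c) * legendre (x - d)) = (\<Sum>x\<in>K - {c}. legendre (x - c) * legendre (x - d))"
    by (rule sum.mono_neutral_right) (auto simp: legendre_def)
  also have "\<dots> = (\<Sum>y\<in>K - {1}. legendre y)"
  proof (rule sum.reindex_bij_witness[of _ "\<lambda>y. c + e / (y - 1)" "\<lambda>x. 1 + e / (x - c)"])
    fix x assume x: "x \<in> K - {c}"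
    have "(x - c) * (x - d) = (x - c)\<^sup>2 * (1 + e / (x - c))"
      using x by (simp add: e_def field_simps power2_eq_square)
    moreover have "1 + e / (x - c) \<in> K" "x - c \<in> K" "x - c \<noteq> 0" "x - d \<in> K"
      using x e assms by auto
    ultimately show "legendre (1 + e / (x - c)) = legendre (x - c) * legendre (x - d)"
      using legendre_square[of "x - c"] legendre_mult[of "(x - c)\<^sup>2" "1 + e / (x - c)"]
        legendre_mult[of "x - c" "x - d"] by simp
  qed (use e assms in auto)
  also have "\<dots> = -1"
    by (subst sum_diff1) (auto simp: sum_legendre)
  finally show ?thesis .
qed

text \<open>The constants 13 and 24 in Stepanov's bound are chosen for the
  application below, where eleven such sums must not outweigh \<open>p\<close>: the ratio \<open>13 / 24\<close> exceeds
  one half by so little that each sum is at most about \<open>p / 12\<close>.  With these constants, the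
  inequality on the number of coefficients holds from \<open>p > 1707\<close> on.\<close>

lemma legendre_cubic_sum_bound:
  fixes f :: "'a poly"
  assumes deg: "degree f = 3" and K: "\<And>x. x \<in> K \<Longrightarrow> poly f x \<in> K" and p: "CHAR('a) > 1707"
  shows "12 * \<bar>\<Sum>x\<in>K. legendre (poly f x)\<bar> \<le> int CHAR('a) + 35"
proof -
  let ?p = "CHAR('a)" and ?m = "(CHAR('a) - 1) div 2"
  define N where "N \<epsilon> = card {x. x ^ ?p = x \<and> poly f x ^ ?m = \<epsilon>}" for \<epsilon> :: 'a
  have m: "?p = 2 * ?m + 1" by (rule char_eq)
  have bound: "24 * N \<epsilon> \<le> 13 * ?p - 1" if "\<epsilon> \<noteq> 0" for \<epsilon>
    unfolding N_def
  proof (rule stepanov_bound)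
    have large: "24 * (k + 13) + 24 * (24 - 1) < 13 * (k - 1) + (13 - 1) * (k + 2)" if "k \<ge> 854" for k :: nat
      using that by simp
    have "?m \<ge> 854" using m p by linarith
    then show "?m \<ge> 1" "24 * (?m + 13) + 24 * (24 - 1) < 13 * (?m - 1) + (13 - 1) * (?m + 2)"
      by (simp, rule large)
  qed (use deg odd_char p that in auto)
  define Z where "Z = {x \<in> K. poly f x = 0}"
  have f0: "f \<noteq> 0" using deg by auto
  have Z: "card Z \<le> 3"
  proof -
    have "card Z \<le> card {x. poly f x = 0}" by (intro card_mono) (auto simp: Z_def)
    then show ?thesis using card_poly_roots_bound[OF f0] deg by simp
  qed
  define P where "P \<epsilon> = {x \<in> K. legendre (poly f x) = \<epsilon>}" for \<epsilon> :: int
  have P: "P 1 = {x. x ^ ?p = x \<and> poly f x ^ ?m = 1}" "P (-1) = {x. x ^ ?p = x \<and> poly f x ^ ?m = -1}"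
    using K legendre_eq_iff(2,3) by (auto simp: P_def prime_subfield_def)
  have K_eq: "K = Z \<union> (P 1 \<union> P (-1))"
    using K legendre_cases by (auto simp: Z_def P_def)
  have dis: "Z \<inter> (P 1 \<union> P (-1)) = {}" "P 1 \<inter> P (-1) = {}"
    by (auto simp: Z_def P_def legendre_def)
  have "card K = card Z + (card (P 1) + card (P (-1)))"
    by (subst K_eq) (simp add: card_Un_disjoint dis)
  then have c: "?p = card Z + (N 1 + N (-1))"
    by (simp add: card_prime_subfield P N_def)
  have "(\<Sum>x\<in>K. legendre (poly f x)) = (\<Sum>x\<in>Z. legendre (poly f x))
      + ((\<Sum>x\<in>P 1. legendre (poly f x)) + (\<Sum>x\<in>P (-1). legendre (poly f x)))"
    by (subst K_eq) (simp add: sum.union_disjoint dis)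
  also have "\<dots> = int (card (P 1)) - int (card (P (-1)))"
    by (simp add: Z_def P_def legendre_def[of 0])
  also have "\<dots> = int (N 1) - int (N (-1))" by (simp add: P N_def)
  finally have E: "(\<Sum>x\<in>K. legendre (poly f x)) = int (N 1) - int (N (-1))" .
  have arith: "12 * \<bar>n - n'\<bar> \<le> q + 35"
    if "24 * n \<le> 13 * q - 1" "24 * n' \<le> 13 * q - 1" "q = z + (n + n')" "z \<le> 3" for n n' q z :: int
    using that by (smt (verit))
  have "24 * int (N \<epsilon>) \<le> 13 * int ?p - 1" if "\<epsilon> \<noteq> 0" for \<epsilon>
    using bound[OF that] p by simp
  moreover have "int ?p = int (card Z) + (int (N 1) + int (N (-1)))" "int (card Z) \<le> 3"
    using c Z by simp_all
  ultimately show ?thesis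
    unfolding E by (intro arith) auto
qed

lemma sum_legendre_triple_bound:
  assumes "a \<in> K" "b \<in> K" "c \<in> K" and p: "CHAR('a) > 1707"
  shows "12 * \<bar>\<Sum>x\<in>K. legendre (x - a) * legendre (x - b) * legendre (x - c)\<bar> \<le> int CHAR('a) + 35"
proof -
  define f where "f = [:-a, 1:] * [:-b, 1:] * [:-c, 1:]"
  have "degree f = 3" unfolding f_def by (simp add: degree_mult_eq)
  moreover have val: "poly f x = (x - a) * (x - b) * (x - c)" for x
    unfolding f_def poly_mult by simp
  ultimately have "12 * \<bar>\<Sum>x\<in>K. legendre (poly f x)\<bar> \<le> int CHAR('a) + 35"
    using assms by (intro legendre_cubic_sum_bound) auto
  then show ?thesis using assms by (simp add: val)
qed

text \<open>The substitution \<open>x = a + 1 / v\<close> moves one of the four roots to infinity and leaves a cubic.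
  The summand 1 is the value of the cubic at \<open>v = 0\<close>, which corresponds to no \<open>x\<close>.\<close>

lemma sum_legendre_quadruple_bound:
  assumes "a \<in> K" "b \<in> K" "c \<in> K" "d \<in> K" and ne: "a \<noteq> b" "a \<noteq> c" "a \<noteq> d" and p: "CHAR('a) > 1707"
  shows "12 * \<bar>(\<Sum>x\<in>K. legendre (x - a) * legendre (x - b) * legendre (x - c) * legendre (x - d)) + 1\<bar>
     \<le> int CHAR('a) + 35"
proof -
  let ?F = "\<lambda>x. legendre (x - a) * legendre (x - b) * legendre (x - c) * legendre (x - d)"
  define f where "f = [:1, a - b:] * [:1, a - c:] * [:1, a - d:]"
  have "degree f = 3" unfolding f_def using ne by (simp add: degree_mult_eq)
  moreover have val: "poly f x = (1 + x * (a - b)) * (1 + x * (a - c)) * (1 + x * (a - d))" for x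
    unfolding f_def poly_mult by simp
  ultimately have bound: "12 * \<bar>\<Sum>x\<in>K. legendre (poly f x)\<bar> \<le> int CHAR('a) + 35"
    using assms by (intro legendre_cubic_sum_bound) auto
  have "(\<Sum>x\<in>K. ?F x) = (\<Sum>x\<in>K - {a}. ?F x)"
    by (rule sum.mono_neutral_right) (auto simp: legendre_def)
  also have "\<dots> = (\<Sum>v\<in>K - {0}. legendre (poly f v))"
  proof (rule sum.reindex_bij_witness[of _ "\<lambda>v. a + 1 / v" "\<lambda>x. 1 / (x - a)"])
    fix x assume x: "x \<in> K - {a}"
    define v where "v = 1 / (x - a)"
    have v: "v \<in> K" "v \<noteq> 0" "x = a + 1 / v" using x assms by (auto simp: v_def)
    have "(x - a) * (x - b) * (x - c) * (x - d) = (inverse v ^ 2)\<^sup>2 * poly f v"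
      using v(2) by (simp add: val v(3) field_simps power2_eq_square)
    moreover have "poly f v \<in> K" using v assms by (auto simp: val)
    moreover have "?F x = legendre ((x - a) * (x - b) * (x - c) * (x - d))"
      using x assms by simp
    ultimately show "legendre (poly f (1 / (x - a))) = ?F x"
      using v legendre_square[of "inverse v ^ 2"] by (simp flip: v_def)
  qed (use assms in auto)
  also have "\<dots> = (\<Sum>v\<in>K. legendre (poly f v)) - 1"
    by (subst sum_diff1) (auto simp: val)
  finally show ?thesis using bound by simp
qed

text \<open>Expanding the product, the constants and the products of at most two characters
  contribute \<open>p - 2\<close>.  The other terms are the four sums with three characters, with
  coefficients 1, 1, 3, 3 in absolute value, and the sum with all four, with coefficient 3.
  So the error is at most \<open>11 / 12\<close> of \<open>p + 35\<close>.\<close>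

lemma four_point_sum_pos:
  assumes K: "a \<in> K" "b \<in> K" "c \<in> K" "d \<in> K"
    and ne: "a \<noteq> b" "a \<noteq> c" "a \<noteq> d" "b \<noteq> c" "b \<noteq> d" "c \<noteq> d" and p: "CHAR('a) > 1707"
  shows "(\<Sum>x\<in>K. (1 - legendre (x - a)) * (1 - legendre (x - b))
      * (1 - legendre (x - c) - legendre (x - d) - 3 * (legendre (x - c) * legendre (x - d)))) > 0"
proof -
  let ?L = "\<lambda>c x. legendre (x - c)"
  define Q where "Q = (\<Sum>x\<in>K. ?L a x * ?L b x * ?L c x * ?L d x)"
  define E where "E a b c = (\<Sum>x\<in>K. ?L a x * ?L b x * ?L c x)" for a b c
  have "(\<Sum>x\<in>K. (1 - ?L a x) * (1 - ?L b x) * (1 - ?L c x - ?L d x - 3 * (?L c x * ?L d x)))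
     = (\<Sum>x\<in>K. 1 - ?L a x - ?L b x - ?L c x - ?L d x
         + ?L a x * ?L b x + ?L a x * ?L c x + ?L a x * ?L d x + ?L b x * ?L c x + ?L b x * ?L d x
         - 3 * (?L c x * ?L d x)
         - ?L a x * ?L b x * ?L c x - ?L a x * ?L b x * ?L d x
         + 3 * (?L a x * ?L c x * ?L d x) + 3 * (?L b x * ?L c x * ?L d x)
         - 3 * (?L a x * ?L b x * ?L c x * ?L d x))"
    by (intro sum.cong refl) (simp add: algebra_simps)
  also have "\<dots> = int CHAR('a) - 2 - E a b c - E a b d + 3 * E a c d + 3 * E b c d - 3 * Q"
    using K ne
    by (simp add: sum.distrib sum_subtractf sum_legendre_shift sum_legendre_pair card_prime_subfield
          E_def Q_def flip: sum_distrib_left)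
  finally have eq: "(\<Sum>x\<in>K. (1 - ?L a x) * (1 - ?L b x) * (1 - ?L c x - ?L d x - 3 * (?L c x * ?L d x)))
    = int CHAR('a) - 2 - E a b c - E a b d + 3 * E a c d + 3 * E b c d - 3 * Q" .
  have split: "12 * e \<le> n \<and> - 12 * e \<le> n" if "12 * \<bar>e\<bar> \<le> n" for e n :: int
    using that by linarith
  have triple: "12 * E a b c \<le> int CHAR('a) + 35 \<and> - 12 * E a b c \<le> int CHAR('a) + 35"
    if "a \<in> K" "b \<in> K" "c \<in> K" for a b c
    using sum_legendre_triple_bound[OF that p] unfolding E_def by (rule split)
  have quadruple: "12 * (Q + 1) \<le> int CHAR('a) + 35 \<and> - 12 * (Q + 1) \<le> int CHAR('a) + 35"
    using sum_legendre_quadruple_bound[OF K ne(1-3) p] unfolding Q_def by (rule split)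
  have arith: "n - 2 - e1 - e2 + 3 * e3 + 3 * e4 - 3 * q > 0"
    if "12 * e1 \<le> n + 35 \<and> - 12 * e1 \<le> n + 35" "12 * e2 \<le> n + 35 \<and> - 12 * e2 \<le> n + 35"
      "12 * e3 \<le> n + 35 \<and> - 12 * e3 \<le> n + 35" "12 * e4 \<le> n + 35 \<and> - 12 * e4 \<le> n + 35"
      "12 * (q + 1) \<le> n + 35 \<and> - 12 * (q + 1) \<le> n + 35" "n > 1707"
    for e1 e2 e3 e4 q n :: int
    using that by simp
  have "int CHAR('a) > 1707" using p by simp
  then show ?thesis
    unfolding eq
    by (rule arith[OF triple[OF K(1,2,3)] triple[OF K(1,2,4)] triple[OF K(1,3,4)] triple[OF K(2,3,4)]
      quadruple])
qed

end

section \<open>Sign patterns on the orbits of a fifth root of unity\<close>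

lemma lessThan_5: "{..<5} = {0, 1, 2, 3, 4 :: nat}"
  by (auto simp: less_Suc_eq eval_nat_numeral)

text \<open>Let \<open>S\<close> be the sum and \<open>P\<close> the product of the five signs.  The cyclic sum is
  \<open>(S\<^sup>2 - 6 * P * S + 5) / 2 = (P * S - 1) * (P * S - 5) / 2\<close>, and \<open>P * S\<close> is one of
  1, 5 and -3.  So it singles out the case that \<open>\<bar>S\<bar>\<close> is 3.\<close>

lemma five_signs_sum_zero:
  fixes c0 c1 c2 c3 c4 :: int
  defines "w \<equiv> \<lambda>a b c d :: int. 1 + a * d + b * c - 3 * (a * d * (b * c))"
  assumes "c0 = 1 \<or> c0 = -1" "c1 = 1 \<or> c1 = -1" "c2 = 1 \<or> c2 = -1" "c3 = 1 \<or> c3 = -1" "c4 = 1 \<or> c4 = -1"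
    and "\<bar>c0 + c1 + c2 + c3 + c4\<bar> \<noteq> 3"
  shows "w c1 c2 c3 c4 + w c2 c3 c4 c0 + w c3 c4 c0 c1 + w c4 c0 c1 c2 + w c0 c1 c2 c3 = 0"
  using assms(2-7) unfolding w_def by (elim disjE; simp)

lemma five_signs_single_plus:
  fixes c0 c1 c2 c3 c4 :: int
  assumes "c0 = 1 \<or> c0 = -1" "c1 = 1 \<or> c1 = -1" "c2 = 1 \<or> c2 = -1" "c3 = 1 \<or> c3 = -1" "c4 = 1 \<or> c4 = -1"
    and "c0 + c1 + c2 + c3 + c4 = -3"
  obtains "c0 = 1" "c1 = -1" "c2 = -1" "c3 = -1" "c4 = -1"
  | "c0 = -1" "c1 = 1" "c2 = -1" "c3 = -1" "c4 = -1"
  | "c0 = -1" "c1 = -1" "c2 = 1" "c3 = -1" "c4 = -1"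
  | "c0 = -1" "c1 = -1" "c2 = -1" "c3 = 1" "c4 = -1"
  | "c0 = -1" "c1 = -1" "c2 = -1" "c3 = -1" "c4 = 1"
  using assms by (elim disjE; simp)

locale fifth_root = odd_char ty for ty :: "'a::finite_field itself" +
  fixes h :: 'a
  assumes char_mod: "CHAR('a) mod 20 = 1" and h_K: "h \<in> K" and h5: "h ^ 5 = 1" and h1: "h \<noteq> 1"
begin

lemma h_nonzero: "h \<noteq> 0"
  using h5 by auto

lemma h_add_5: "h ^ (n + 5) = h ^ n"
  by (simp add: power_add h5)

lemma h_power_mod: "h ^ (n mod 5) = h ^ n"
  using h5 by (rule fifth_root_power_mod)

lemma h_power_ne_1: "h ^ j \<noteq> 1" if "j mod 5 \<noteq> 0"
proof
  assume 1: "h ^ j = 1"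
  have "j mod 5 \<in> {1, 2, 3, 4}" using that by auto
  then have "(j mod 5) ^ 4 mod 5 = 1" by auto
  then have "j ^ 4 mod 5 = 1" by (simp add: power_mod)
  then have "h ^ (j ^ 4) = h" using h_power_mod[of "j ^ 4"] by simp
  moreover have "h ^ (j ^ 4) = (h ^ j) ^ (j ^ 3)"
    by (simp add: eval_nat_numeral flip: power_mult)
  ultimately show False using 1 h1 by simp
qed

lemma legendre_minus_1: "legendre (-1::'a) = 1"
proof -
  have "even ((CHAR('a) - 1) div 2)" using char_mod by presburger
  then show ?thesis by (simp add: legendre_def)
qed

lemma legendre_uminus: "x \<in> K \<Longrightarrow> legendre (- x) = legendre x"
  using legendre_mult[of "-1" x] legendre_minus_1 by simp

lemma four_nonzero: "(4::'a) \<noteq> 0"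
proof -
  have "(2::'a) * 2 \<noteq> 0" by (simp only: mult_eq_0_iff two_nonzero) simp
  then show ?thesis by simp
qed

lemma legendre_eq_1_imp_square:
  assumes "y \<in> K" "legendre y = 1"
  shows "\<exists>d\<in>K. y = d\<^sup>2"
proof -
  let ?m = "(CHAR('a) - 1) div 2"
  have "card (K - {0}) = 2 * ?m"
    using char_eq by (simp add: card_Diff_singleton card_prime_subfield)
  moreover have "d ^ (2 * ?m) = 1" if "d \<in> K - {0}" for d
  proof -
    have "d * d ^ (2 * ?m) = d"
      using that char_eq by (simp add: prime_subfield_def flip: power_Suc)
    then show ?thesis using that by simp
  qed
  ultimately have "(\<lambda>d. d\<^sup>2) ` (K - {0}) = {x. x ^ ?m = 1}"
    by (intro squares_eq_half_power_kernel half_pos)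
  moreover have "y \<in> {x. x ^ ?m = 1}" using assms legendre_eq_iff(2) by auto
  ultimately show ?thesis by blast
qed

lemma legendre_h: "legendre h = 1"
proof -
  have "h = (h ^ 3)\<^sup>2" using h_add_5[of 1] by (simp flip: power_mult)
  then show ?thesis using legendre_square[of "h ^ 3"] h_K h_nonzero by simp
qed

definition nonresidues :: "'a set" where
  "nonresidues = {t \<in> K. legendre t = -1}"

lemma nonresidueD: "t \<in> nonresidues \<Longrightarrow> t \<in> K \<and> t \<noteq> 0 \<and> legendre t = -1"
  by (auto simp: nonresidues_def legendre_def)

lemma nonresidue_times_h: "t \<in> nonresidues \<Longrightarrow> t * h ^ i \<in> nonresidues"
  using h_K by (auto simp: nonresidues_def legendre_h legendre_power)

text \<open>If \<open>legendre\<close> agrees with the quadratic character of the whole field, the sign tells whether the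
  vertex \<open>r * h ^ i\<close> with a residue \<open>r\<close> is adjacent to \<open>t * r * h ^ (i + j)\<close>.\<close>

definition sgn_at :: "'a \<Rightarrow> nat \<Rightarrow> int" where
  "sgn_at t j = legendre (1 - t * h ^ j)"

lemma sgn_at_mod: "sgn_at t (j mod 5) = sgn_at t j"
  by (simp add: sgn_at_def h_power_mod)

lemma sgn_at_reduce:
  "sgn_at t 5 = sgn_at t 0" "sgn_at t 6 = sgn_at t 1" "sgn_at t 7 = sgn_at t 2" "sgn_at t 8 = sgn_at t 3"
  using sgn_at_mod[of t 5] sgn_at_mod[of t 6] sgn_at_mod[of t 7] sgn_at_mod[of t 8] by simp_all

lemma sgn_at_cases:
  assumes "t \<in> nonresidues" shows "sgn_at t j = 1 \<or> sgn_at t j = -1"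
proof -
  have "1 - t * h ^ j \<noteq> 0"
    using nonresidueD[OF nonresidue_times_h[OF assms, of j]] by auto
  then show ?thesis
    unfolding sgn_at_def using assms h_K by (intro legendre_cases) (auto simp: nonresidues_def)
qed

text \<open>Summed over an orbit of multiplication by \<open>h\<close>, this becomes the cyclic sum of
  \<open>five_signs_sum_zero\<close>.  Leaving out \<open>sgn_at t 0\<close> makes it a function of
  \<open>t + 1 / t\<close>, because \<open>h\<close> and \<open>h ^ 4\<close>, as well as \<open>h ^ 2\<close> and \<open>h ^ 3\<close>, are inverse to each other.\<close>

definition weight :: "'a \<Rightarrow> int" where
  "weight t = 1 + sgn_at t 1 * sgn_at t 4 + sgn_at t 2 * sgn_at t 3
     - 3 * (sgn_at t 1 * sgn_at t 4 * (sgn_at t 2 * sgn_at t 3))"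

lemma sum_weight_orbit:
  assumes t: "t \<in> nonresidues" and S: "\<bar>\<Sum>j<5. sgn_at t j\<bar> \<noteq> 3"
  shows "(\<Sum>i<5. weight (t * h ^ i)) = 0"
proof -
  have shift: "sgn_at (t * h ^ i) j = sgn_at t (i + j)" for i j
    by (simp add: sgn_at_def power_add mult_ac)
  have "\<bar>sgn_at t 0 + sgn_at t 1 + sgn_at t 2 + sgn_at t 3 + sgn_at t 4\<bar> \<noteq> 3"
    using S by (simp add: lessThan_5 add_ac)
  note five_signs_sum_zero[OF sgn_at_cases[OF t, of 0] sgn_at_cases[OF t, of 1] sgn_at_cases[OF t, of 2]
      sgn_at_cases[OF t, of 3] sgn_at_cases[OF t, of 4] this]
  then show ?thesis
    using sgn_at_reduce[of t] by (simp add: weight_def shift lessThan_5 eval_nat_numeral)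
qed

text \<open>The weight in terms of \<open>u = t + 1 / t\<close>.  For a nonresidue \<open>t\<close>, the factorisation
  \<open>(1 - t * h) * (1 - t * h ^ 4) = t * (u - (h + h ^ 4))\<close> turns the product of two signs into the
  negative of a single character value, and likewise for \<open>h ^ 2\<close> and \<open>h ^ 3\<close>.\<close>

definition trace_weight :: "'a \<Rightarrow> int" where
  "trace_weight u = 1 - legendre (u - (h + h ^ 4)) - legendre (u - (h ^ 2 + h ^ 3))
     - 3 * (legendre (u - (h + h ^ 4)) * legendre (u - (h ^ 2 + h ^ 3)))"

lemma weight_eq_trace_weight:
  assumes t: "t \<in> nonresidues"
  shows "weight t = trace_weight (t + 1 / t)"
proof -
  note t' = nonresidueD[OF t]
  have h: "h ^ 4 * h = 1" "h ^ 3 * h ^ 2 = 1" using h5 by (simp_all flip: power_add power_Suc2)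
  have "sgn_at t i * sgn_at t j = - legendre (t + 1 / t - (h ^ i + h ^ j))"
    if "h ^ j * h ^ i = 1" for i j
  proof -
    have "(1 - t * h ^ i) * (1 - t * h ^ j) = t * (t + 1 / t - (h ^ i + h ^ j))"
      using that t' by (simp add: algebra_simps flip: power_mult_distrib)
    then show ?thesis
      using t' h_K legendre_mult[of "1 - t * h ^ i" "1 - t * h ^ j"]
        legendre_mult[of t "t + 1 / t - (h ^ i + h ^ j)"] by (simp add: sgn_at_def)
  qed
  from this[of 4 1] this[of 3 2] show ?thesis
    using h by (simp add: weight_def trace_weight_def)
qed

text \<open>The solutions \<open>t\<close> of \<open>t + 1 / t = u\<close> have discriminant \<open>(u - 2) * (u + 2)\<close>, and
  \<open>u + 2 = (t + 1)\<^sup>2 / t\<close> and \<open>u - 2 = (t - 1)\<^sup>2 / t\<close> have the same character value as \<open>t\<close>.  So there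
  are two nonresidue solutions if both \<open>u - 2\<close> and \<open>u + 2\<close> are nonresidues, and otherwise
  none.  In the degenerate cases \<open>u = 2\<close> and \<open>u = -2\<close> the right-hand side is zero as well,
  because 4 and -4 are squares.\<close>

lemma card_nonresidue_fibre:
  assumes u: "u \<in> K"
  shows "2 * int (card {t \<in> nonresidues. t + 1 / t = u}) = (1 - legendre (u - 2)) * (1 - legendre (u + 2))"
proof -
  have sq: "t + 1 / t - 2 = (t - 1)\<^sup>2 / t" "t + 1 / t + 2 = (t + 1)\<^sup>2 / t" if "t \<noteq> 0" for t :: 'a
    using that by (simp_all add: field_simps power2_eq_square)
  have leg: "legendre (t + 1 / t - 2) = -1" "legendre (t + 1 / t + 2) = -1" "t\<^sup>2 \<noteq> 1"
    if "t \<in> nonresidues" for t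
  proof -
    note t = nonresidueD[OF that]
    have ne: "t \<noteq> 1" "t \<noteq> -1" using t legendre_minus_1 by auto
    then show "t\<^sup>2 \<noteq> 1" by (simp add: power2_eq_1_iff)
    have "legendre (x\<^sup>2 / t) = -1" if "x \<in> K" "x \<noteq> 0" for x
      using that t legendre_mult[of "x\<^sup>2" "inverse t"] legendre_inverse[of t] legendre_square[of x]
      by (simp add: divide_inverse)
    from this[of "t - 1"] this[of "t + 1"] show "legendre (t + 1 / t - 2) = -1" "legendre (t + 1 / t + 2) = -1"
      using t ne sq by (auto simp: eq_neg_iff_add_eq_0)
  qed
  show ?thesis
  proof (cases "legendre (u - 2) = -1 \<and> legendre (u + 2) = -1")
    case True
    have ne: "(u - 2) * (u + 2) \<noteq> 0" using True by (auto simp: legendre_def)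
    have "legendre ((u - 2) * (u + 2)) = 1" using True u by simp
    then obtain d where d: "d \<in> K" "(u - 2) * (u + 2) = d\<^sup>2"
      using legendre_eq_1_imp_square[of "(u - 2) * (u + 2)"] u by auto
    have d0: "d \<noteq> 0" using ne d(2) by auto
    define t where "t = (u + d) / 2"
    define t' where "t' = (u - d) / 2"
    have tt': "t * t' = 1" "t + t' = u" "t \<noteq> t'"
    proof -
      have two: "2 * t = u + d" "2 * t' = u - d" by (simp_all add: t_def t'_def)
      then have "(2 * t) * (2 * t') = u\<^sup>2 - d\<^sup>2"
        by (simp only: power2_eq_square square_diff_square_factored)
      then have "4 * (t * t') = u\<^sup>2 - d\<^sup>2" by (simp add: mult_ac)
      also have "\<dots> = 4 * 1" by (simp flip: d(2)) (simp add: algebra_simps power2_eq_square)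
      finally show "t * t' = 1" using four_nonzero by simp
      have "2 * (t + t') = 2 * u" by (simp only: distrib_left two) simp
      then show "t + t' = u" by (simp only: mult_cancel_left two_nonzero) simp
      have "2 * (t - t') = 2 * d" by (simp only: right_diff_distrib two) simp
      then show "t \<noteq> t'" using d0 by auto
    qed
    have mem: "x \<in> nonresidues" if "x \<in> K" "x \<noteq> 0" "x + 1 / x = u" for x
    proof -
      have x1: "x + 1 \<noteq> 0"
      proof
        assume "x + 1 = 0"
        then have "u + 2 = 0" using sq(2)[of x] that by simp
        then show False using ne by simp
      qed
      have "x * (u + 2) = (x + 1)\<^sup>2" using sq(2)[of x] that by simp
      then have "legendre (x * (u + 2)) = 1" using legendre_square[of "x + 1"] x1 that(1) by simp
      then have "legendre x * -1 = 1" using True that(1) u by simp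
      then show ?thesis using that(1) by (simp add: nonresidues_def)
    qed
    have K: "t \<in> K" "t' \<in> K" using u d(1) by (simp_all add: t_def t'_def)
    have nz: "t \<noteq> 0" "t' \<noteq> 0" using tt'(1) by auto
    have inv: "1 / t = t'" "1 / t' = t"
      using tt'(1) nz by (simp_all add: field_simps)
    have "{x \<in> nonresidues. x + 1 / x = u} = {t, t'}"
    proof (intro equalityI subsetI)
      fix x assume x: "x \<in> {x \<in> nonresidues. x + 1 / x = u}"
      then have x0: "x \<noteq> 0" using nonresidueD by blast
      have "(x - t) * (x - t') = x * (x + 1 / x - (t + t'))"
        using x0 tt'(1) by (simp add: algebra_simps)
      then show "x \<in> {t, t'}" using x tt'(2) by auto
    qed (use mem[of t] mem[of t'] K nz inv tt'(2) in \<open>auto simp: add.commute\<close>)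
    then have "card {t \<in> nonresidues. t + 1 / t = u} = 2" using tt'(3) by simp
    then show ?thesis using True by simp
  next
    case False
    then have "{t \<in> nonresidues. t + 1 / t = u} = {}" using leg by auto
    moreover have "legendre (u - 2) = 1 \<or> legendre (u + 2) = 1"
    proof (rule ccontr)
      assume not1: "\<not> ?thesis"
      then have "u - 2 = 0 \<or> u + 2 = 0"
        using False legendre_cases[of "u - 2"] legendre_cases[of "u + 2"] u by auto
      then have "u = 2 \<or> u = - 2" by (auto simp: eq_neg_iff_add_eq_0)
      moreover have "legendre (4::'a) = 1" using legendre_square[of 2] by simp
      moreover have "legendre (-4::'a) = 1" using legendre_uminus[of 4] \<open>legendre 4 = 1\<close> by simp
      ultimately show False using not1 by auto
    qed
    ultimately show ?thesis by auto
  qed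
qed

text \<open>The sum of all weights would vanish if no orbit had \<open>\<bar>S\<bar> = 3\<close>.  But twice this sum is a
  four-point sum at 2, -2 and the two traces \<open>h + h ^ 4\<close>, \<open>h ^ 2 + h ^ 3\<close>, hence positive.\<close>

lemma exists_orbit_sum_3_of_large_char:
  assumes p: "CHAR('a) > 1707"
  shows "\<exists>t\<in>nonresidues. \<bar>\<Sum>j<5. sgn_at t j\<bar> = 3"
proof (rule ccontr)
  assume none: "\<not> ?thesis"
  define s s' where "s = h + h ^ 4" and "s' = h ^ 2 + h ^ 3"
  have red: "h * h ^ 4 = 1" "h ^ 2 * h ^ 3 = 1" "h ^ 6 = h" "h ^ 7 = h ^ 2"
    using h5 h_add_5[of 1] h_add_5[of 2] by (simp_all flip: power_Suc power_add)
  have ne1: "h ^ j \<noteq> 1" "h ^ j \<noteq> -1" if "j \<in> {1, 2}" for j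
  proof -
    show "h ^ j \<noteq> 1" using that by (intro h_power_ne_1) auto
    have "h ^ (2 * j) \<noteq> 1" using that by (intro h_power_ne_1) auto
    then show "h ^ j \<noteq> -1" by (auto simp: power_mult mult.commute[of 2])
  qed
  \<comment> \<open>The four points are distinct: their differences are products of factors \<open>h ^ j - 1\<close> and \<open>h ^ j + 1\<close>.\<close>
  have "s - 2 = h ^ 4 * (h - 1)\<^sup>2" "s - (-2) = h ^ 4 * (h + 1)\<^sup>2"
    "s' - 2 = h ^ 3 * (h ^ 2 - 1)\<^sup>2" "s' - (-2) = h ^ 3 * (h ^ 2 + 1)\<^sup>2"
    using red h5 by (simp_all add: s_def s'_def power2_eq_square algebra_simps flip: power_add power_Suc)
  moreover have "s - s' = h * (1 - h) * (1 - h ^ 2)"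
    by (simp add: s_def s'_def algebra_simps eval_nat_numeral)
  ultimately have ne: "s \<noteq> 2" "s \<noteq> -2" "s' \<noteq> 2" "s' \<noteq> -2" "s \<noteq> s'"
    using ne1[of 1] ne1[of 2] h_nonzero by (auto simp: eq_neg_iff_add_eq_0)
  have ne2: "(2::'a) \<noteq> -2" using four_nonzero by (simp add: eq_neg_iff_add_eq_0)

  have fin: "finite nonresidues" "finite K" by auto
  have "(\<Sum>t\<in>nonresidues. weight t) = (\<Sum>t\<in>nonresidues. trace_weight (t + 1 / t))"
    by (intro sum.cong refl weight_eq_trace_weight)
  also have "\<dots> = (\<Sum>u\<in>K. int (card {t \<in> nonresidues. t + 1 / t = u}) * trace_weight u)"
    using sum_fun_comp[OF fin, of "\<lambda>t. t + 1 / t" trace_weight] by (force simp: nonresidues_def)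
  finally have "2 * (\<Sum>t\<in>nonresidues. weight t)
      = (\<Sum>u\<in>K. 2 * int (card {t \<in> nonresidues. t + 1 / t = u}) * trace_weight u)"
    by (simp add: sum_distrib_left mult.assoc)
  also have "\<dots> = (\<Sum>u\<in>K. (1 - legendre (u - 2)) * (1 - legendre (u - (-2))) * trace_weight u)"
    by (intro sum.cong refl) (simp only: card_nonresidue_fibre diff_minus_eq_add)
  also have "\<dots> > 0"
    using four_point_sum_pos[of 2 "-2" s s'] h_K ne ne2 p
    by (simp add: trace_weight_def s_def s'_def)
  finally have pos: "(\<Sum>t\<in>nonresidues. weight t) > 0" by simp

  have "(\<Sum>t\<in>nonresidues. weight (t * h ^ i)) = (\<Sum>t\<in>nonresidues. weight t)" for i
  proof (rule sum.reindex_bij_witness[of _ "\<lambda>t. t * h ^ (4 * i)" "\<lambda>t. t * h ^ i"])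
    have "h ^ (4 * i) * h ^ i = 1"
      using h5 by (simp flip: power_add) (simp add: power_mult flip: mult_Suc)
    then show "t * h ^ (4 * i) * h ^ i = t" "t * h ^ i * h ^ (4 * i) = t" for t
      by (simp_all add: mult.assoc mult.commute[of "h ^ i"])
  qed (auto intro: nonresidue_times_h)
  then have "5 * (\<Sum>t\<in>nonresidues. weight t) = (\<Sum>i<(5::nat). \<Sum>t\<in>nonresidues. weight (t * h ^ i))"
    by simp
  also have "\<dots> = (\<Sum>t\<in>nonresidues. \<Sum>i<5. weight (t * h ^ i))"
    by (rule sum.swap)
  also have "\<dots> = 0"
    using none by (intro sum.neutral ballI sum_weight_orbit) auto
  finally show False using pos by simp
qed

text \<open>Replacing \<open>t\<close> by its inverse exchanges the two signs, as
  \<open>t * (1 - h ^ i / t) = - (h ^ i) * (1 - t * h ^ j)\<close> and \<open>t\<close> is a nonresidue.  So the sums 3 and -3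
  are equally good.\<close>

lemma sgn_at_inverse:
  assumes "t \<in> nonresidues" "i + j = 5"
  shows "sgn_at (1 / t) i = - sgn_at t j"
proof -
  note t = nonresidueD[OF assms(1)]
  have "h ^ i * h ^ j = 1" using assms(2) h5 by (simp flip: power_add)
  then have "t * (1 - 1 / t * h ^ i) = - (h ^ i) * (1 - t * h ^ j)"
    using t by (simp add: algebra_simps)
  then have "legendre (t * (1 - 1 / t * h ^ i)) = legendre (- (h ^ i) * (1 - t * h ^ j))" by simp
  then show ?thesis
    using t h_K by (simp add: sgn_at_def legendre_uminus legendre_power legendre_h)
qed

text \<open>Exactly one of the five signs is positive for \<open>t\<close> or for its inverse, and multiplication by a
  power of \<open>h\<close> moves it to index zero.\<close>

lemma exists_good_nonresidue_of_orbit_sum_3: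
  assumes t: "t \<in> nonresidues" and S: "\<bar>\<Sum>j<5. sgn_at t j\<bar> = 3"
  shows "\<exists>n\<in>K. legendre n = -1 \<and> legendre (1 - n) = 1 \<and> (\<forall>j\<in>{1..4}. legendre (1 - n * h ^ j) = -1)"
proof -
  obtain r where r: "r \<in> nonresidues" "(\<Sum>j<5. sgn_at r j) = -3"
  proof (cases "(\<Sum>j<5. sgn_at t j) = 3")
    case True
    have "1 / t \<in> nonresidues"
      using t legendre_inverse[of t] by (auto simp: nonresidues_def divide_inverse)
    moreover have "(\<Sum>j<5. sgn_at (1 / t) j) = - (\<Sum>j<5. sgn_at t j)"
      using sgn_at_inverse[OF t, of 5 0] sgn_at_inverse[OF t, of 1 4] sgn_at_inverse[OF t, of 2 3]
        sgn_at_inverse[OF t, of 3 2] sgn_at_inverse[OF t, of 4 1] sgn_at_mod[of "1 / t" 5]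
      by (simp add: lessThan_5)
    ultimately show ?thesis using that True by simp
  qed (use that t S in auto)
  have "\<exists>c. sgn_at r c = 1 \<and> sgn_at r (c + 1) = -1 \<and> sgn_at r (c + 2) = -1
      \<and> sgn_at r (c + 3) = -1 \<and> sgn_at r (c + 4) = -1"
  proof -
    have "sgn_at r 0 + sgn_at r 1 + sgn_at r 2 + sgn_at r 3 + sgn_at r 4 = -3"
      using r(2) by (simp add: lessThan_5 add_ac)
    with sgn_at_cases[OF r(1), of 0] sgn_at_cases[OF r(1), of 1] sgn_at_cases[OF r(1), of 2]
      sgn_at_cases[OF r(1), of 3] sgn_at_cases[OF r(1), of 4]
    show ?thesis
    proof (cases rule: five_signs_single_plus)
      case 1 then show ?thesis using sgn_at_reduce[of r] by (intro exI[of _ 0]) (simp add: eval_nat_numeral)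
    next
      case 2 then show ?thesis using sgn_at_reduce[of r] by (intro exI[of _ 1]) (simp add: eval_nat_numeral)
    next
      case 3 then show ?thesis using sgn_at_reduce[of r] by (intro exI[of _ 2]) (simp add: eval_nat_numeral)
    next
      case 4 then show ?thesis using sgn_at_reduce[of r] by (intro exI[of _ 3]) (simp add: eval_nat_numeral)
    next
      case 5 then show ?thesis using sgn_at_reduce[of r] by (intro exI[of _ 4]) (simp add: eval_nat_numeral)
    qed
  qed
  then obtain c where c': "sgn_at r c = 1" "sgn_at r (c + 1) = -1" "sgn_at r (c + 2) = -1"
      "sgn_at r (c + 3) = -1" "sgn_at r (c + 4) = -1"
    by blast
  have "sgn_at r (c + j) = -1" if "j \<in> {1..4}" for j
  proof -
    from that have "j = 1 \<or> j = 2 \<or> j = 3 \<or> j = 4" by auto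
    then show ?thesis using c' by auto
  qed
  note c = c'(1) this
  show ?thesis
    using nonresidueD[OF nonresidue_times_h[OF r(1), of c]] c
    by (intro bexI[of _ "r * h ^ c"]) (auto simp: sgn_at_def power_add mult.assoc)
qed

end

section \<open>Small characteristics\<close>

text \<open>A certificate for the characteristic \<open>p\<close>: \<open>g\<close> is a primitive fifth root of unity, \<open>n\<close> is a
  nonresidue, \<open>1 - n\<close> is the square of \<open>r\<^sub>0\<close>, and \<open>1 - n * g ^ j\<close> is \<open>n\<close> times the square of
  \<open>r\<^sub>j\<close>, so a nonresidue.  Only one modular power has to be evaluated.\<close>

fun is_witness :: "nat \<times> nat \<times> nat \<times> nat \<times> nat \<times> nat \<times> nat \<times> nat \<Rightarrow> bool" where
  "is_witness (p, g, n, r\<^sub>0, r\<^sub>1, r\<^sub>2, r\<^sub>3, r\<^sub>4) \<longleftrightarrow>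
     1 < g \<and> g < p \<and> g ^ 5 mod p = 1 \<and> mod_exp n ((p - 1) div 2) p = p - 1 \<and> (r\<^sub>0 ^ 2 + n) mod p = 1
     \<and> n * (r\<^sub>1 ^ 2 + g) mod p = 1 \<and> n * (r\<^sub>2 ^ 2 + g ^ 2) mod p = 1
     \<and> n * (r\<^sub>3 ^ 2 + g ^ 3) mod p = 1 \<and> n * (r\<^sub>4 ^ 2 + g ^ 4) mod p = 1"

definition small_witnesses :: "(nat \<times> nat \<times> nat \<times> nat \<times> nat \<times> nat \<times> nat \<times> nat) list" where
  "small_witnesses =
    [(41, 10, 3, 11, 2, 18, 11, 10), (61, 9, 26, 6, 17, 20, 22, 9), (101, 36, 34, 13, 13, 11, 3, 44),
     (181, 42, 40, 88, 15, 48, 82, 88), (241, 87, 65, 30, 22, 49, 38, 33), (281, 86, 3, 29, 17, 2, 28, 108),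
     (401, 39, 91, 172, 107, 194, 17, 157), (421, 252, 29, 136, 154, 173, 65, 59), (461, 88, 42, 139, 98, 131, 227, 11),
     (521, 25, 134, 221, 56, 85, 112, 224), (541, 48, 8, 93, 195, 99, 260, 151), (601, 32, 95, 293, 83, 33, 250, 41),
     (641, 357, 3, 62, 175, 18, 32, 142), (661, 197, 54, 278, 217, 207, 283, 257), (701, 89, 126, 24, 166, 193, 137, 151),
     (761, 67, 310, 243, 245, 365, 353, 149), (821, 51, 111, 90, 97, 301, 368, 33), (881, 268, 3, 396, 94, 255, 227, 84),
     (941, 349, 35, 147, 383, 74, 380, 323), (1021, 589, 76, 399, 249, 309, 361, 302), (1061, 220, 2, 103, 231, 172, 499, 348),
     (1181, 81, 63, 59, 498, 385, 551, 261), (1201, 105, 22, 235, 37, 92, 354, 573), (1301, 163, 50, 357, 340, 602, 16, 389),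
     (1321, 133, 38, 337, 307, 284, 112, 442), (1361, 211, 19, 52, 501, 224, 364, 436), (1381, 75, 142, 290, 499, 374, 63, 193),
     (1481, 136, 3, 315, 594, 285, 596, 408), (1601, 42, 117, 475, 540, 70, 105, 432), (1621, 231, 40, 441, 246, 250, 657, 212)]"

lemma small_witnesses_correct: "list_all is_witness small_witnesses"
  by (simp add: small_witnesses_def)

text \<open>A composite number below \<open>43\<^sup>2\<close> has a prime factor of at most 41; the factors 2 and 5 cannot occur.\<close>

lemma small_witnesses_complete:
  "list_all (\<lambda>k. 20 * k + 1 \<in> set (map fst small_witnesses)
     \<or> list_ex (\<lambda>d. d dvd 20 * k + 1 \<and> d \<noteq> 20 * k + 1) [3, 7, 11, 13, 17, 19, 23, 29, 31, 37, 41]) [1..<86]"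
  by (simp add: small_witnesses_def upt_rec)

context fifth_root
begin

lemma inj_on_h_power: "inj_on (\<lambda>i. h ^ i) {..<5}"
proof (rule linorder_inj_onI)
  fix i j :: nat assume ij: "i < j" "i \<in> {..<5}" "j \<in> {..<5}"
  then have "(j - i) mod 5 \<noteq> 0" by auto
  then have "h ^ (j - i) \<noteq> 1" by (rule h_power_ne_1)
  moreover have "h ^ j = h ^ i * h ^ (j - i)" using ij(1) by (simp flip: power_add)
  ultimately show "h ^ i \<noteq> h ^ j" using h_nonzero by auto
qed auto

lemma fifth_root_eq_h_power:
  assumes "x ^ 5 = 1" shows "\<exists>i<5. x = h ^ i"
proof -
  have "(h ^ i) ^ 5 = 1" for i
    by (metis h5 mult.commute power_mult power_one)
  then have "(\<lambda>i. h ^ i) ` {..<5} \<subseteq> {x. x ^ 5 = 1}" by auto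
  moreover have "card {x::'a. x ^ 5 = 1} \<le> card ((\<lambda>i. h ^ i) ` {..<5::nat})"
    using card_power_eq_le[of 5 "1::'a"] by (simp add: card_image[OF inj_on_h_power])
  ultimately have "(\<lambda>i. h ^ i) ` {..<5} = {x. x ^ 5 = 1}" by (intro card_seteq) auto
  then show ?thesis using assms by auto
qed

text \<open>The certificate is about one primitive fifth root of unity.  The assertion is about all powers
  of \<open>h\<close> together, so it does not depend on the choice of the root.\<close>

lemma exists_good_nonresidue_of_small_char:
  assumes small: "CHAR('a) \<le> 1707"
  shows "\<exists>n\<in>K. legendre n = -1 \<and> legendre (1 - n) = 1 \<and> (\<forall>j\<in>{1..4}. legendre (1 - n * h ^ j) = -1)"
proof -
  let ?p = "CHAR('a)"
  have prime: "prime ?p" by simp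
  define k where "k = ?p div 20"
  have k: "?p = 20 * k + 1" using char_mod div_mult_mod_eq[of ?p 20] by (simp add: k_def)
  have "k \<in> set [1..<86]" using k small prime_gt_1_nat[OF prime] by auto
  then have "?p \<in> set (map fst small_witnesses)
      \<or> list_ex (\<lambda>d. d dvd ?p \<and> d \<noteq> ?p) [3, 7, 11, 13, 17, 19, 23, 29, 31, 37, 41]"
    using small_witnesses_complete unfolding list_all_iff k by blast
  moreover have "\<not> list_ex (\<lambda>d. d dvd ?p \<and> d \<noteq> ?p) [3, 7, 11, 13, 17, 19, 23, 29, 31, 37, 41]"
    using prime_nat_iff[THEN iffD1, OF prime] by (auto simp: list_ex_iff)
  ultimately have "?p \<in> fst ` set small_witnesses" by (simp only: set_map) blast
  then obtain w where w_in: "w \<in> set small_witnesses" and w_fst: "?p = fst w" by (rule imageE)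
  obtain p' g n r\<^sub>0 r\<^sub>1 r\<^sub>2 r\<^sub>3 r\<^sub>4
    where w_eq: "w = (p', g, n, r\<^sub>0, r\<^sub>1, r\<^sub>2, r\<^sub>3, r\<^sub>4)"
    by (metis surj_pair)
  have w: "is_witness (?p, g, n, r\<^sub>0, r\<^sub>1, r\<^sub>2, r\<^sub>3, r\<^sub>4)"
    using bspec[OF small_witnesses_correct[unfolded list_all_iff] w_in] w_fst
    by (simp only: w_eq fst_conv)
  have red: "of_nat (x mod ?p) = (of_nat x :: 'a)" for x
  proof -
    have "of_nat x = (of_nat (x div ?p * ?p + x mod ?p) :: 'a)" by simp
    also have "\<dots> = of_nat (x mod ?p)" by (simp only: of_nat_add of_nat_mult of_nat_CHAR) simp
    finally show ?thesis by simp
  qed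
  have one: "(of_nat x :: 'a) = 1" if "x mod ?p = 1" for x using red[of x] that by simp
  define G N :: 'a where "G = of_nat g" and "N = of_nat n"
  define R :: "nat \<Rightarrow> 'a" where "R j = of_nat ([r\<^sub>0, r\<^sub>1, r\<^sub>2, r\<^sub>3, r\<^sub>4] ! j)" for j
  have NK: "N \<in> K" and RK: "R j \<in> K" for j by (simp_all add: N_def R_def)
  have G5: "G ^ 5 = 1" using one[of "g ^ 5"] w by (simp add: G_def)
  have "\<not> ?p dvd (g - 1)" using w by (auto dest: dvd_imp_le)
  then have "of_nat (g - 1) \<noteq> (0::'a)" by (simp add: of_nat_eq_0_iff_char_dvd)
  then have G1: "G \<noteq> 1" using w by (simp add: G_def of_nat_diff)
  have "N ^ ((?p - 1) div 2) = of_nat (n ^ ((?p - 1) div 2) mod ?p)" by (simp add: N_def red)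
  also have "\<dots> = of_nat (?p - 1)" using w by (simp add: mod_exp_def)
  also have "\<dots> = -1" using prime_gt_1_nat[OF prime] by (simp add: of_nat_diff)
  finally have legN: "legendre N = -1" using legendre_eq_iff(3)[OF NK] by simp
  have "R 0 ^ 2 + N = 1" using one[of "r\<^sub>0 ^ 2 + n"] w by (simp add: R_def N_def)
  then have R0: "1 - N = (R 0)\<^sup>2" by (simp add: eq_diff_eq diff_eq_eq)
  have NR: "N * (R j ^ 2 + G ^ j) = 1" if "j \<in> {1..4}" for j
  proof -
    have nr: "N * (R 1 ^ 2 + G ^ 1) = 1" "N * (R 2 ^ 2 + G ^ 2) = 1"
      "N * (R 3 ^ 2 + G ^ 3) = 1" "N * (R 4 ^ 2 + G ^ 4) = 1"
      using w one[of "n * (r\<^sub>1 ^ 2 + g)"] one[of "n * (r\<^sub>2 ^ 2 + g ^ 2)"]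
        one[of "n * (r\<^sub>3 ^ 2 + g ^ 3)"] one[of "n * (r\<^sub>4 ^ 2 + g ^ 4)"]
      by (simp_all add: R_def N_def G_def)
    from that have "j = 1 \<or> j = 2 \<or> j = 3 \<or> j = 4" by auto
    then show ?thesis using nr by (elim disjE) simp_all
  qed
  obtain i where i: "i < 5" "G = h ^ i" using fifth_root_eq_h_power[OF G5] by blast
  have i0: "i \<noteq> 0" using i G1 by (intro notI) simp
  have "legendre (1 - N) = 1"
  proof -
    have "R 0 \<noteq> 0" using R0 legN by auto
    then show ?thesis unfolding R0 by (rule legendre_square[OF RK])
  qed
  moreover have "legendre (1 - N * h ^ j) = -1" if j: "j \<in> {1..4}" for j
  proof -
    \<comment> \<open>As \<open>G = h ^ i\<close> and \<open>i ^ 4\<close> is 1 modulo 5, raising \<open>G\<close> to the power \<open>i ^ 3 * j\<close> gives \<open>h ^ j\<close>.\<close>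
    define l where "l = i ^ 3 * j mod 5"
    have "i = 1 \<or> i = 2 \<or> i = 3 \<or> i = 4" using i(1) i0 by presburger
    moreover have "j = 1 \<or> j = 2 \<or> j = 3 \<or> j = 4" using j by auto
    ultimately have "l \<in> {1..4} \<and> i * l mod 5 = j"
      unfolding l_def by (elim disjE) simp_all
    then have l: "l \<in> {1..4}" "i * l mod 5 = j" by simp_all
    then have "G ^ l = h ^ j" using h_power_mod[of "i * l"] by (simp add: i power_mult)
    then have eq: "1 - N * h ^ j = N * (R l)\<^sup>2" using NR[OF l(1)] by (simp add: algebra_simps diff_eq_eq)
    have "N * h ^ j \<noteq> 1"
    proof
      assume "N * h ^ j = 1"
      then have "legendre (N * h ^ j) = 1" by simp
      then show False using NK h_K legN by (simp add: legendre_power legendre_h)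
    qed
    then have "R l \<noteq> 0" using eq by auto
    then show ?thesis unfolding eq using NK RK[of l] legN legendre_square[of "R l"] by simp
  qed
  ultimately show ?thesis using NK legN by blast
qed

text \<open>If \<open>legendre\<close> agrees with the quadratic character of the whole field, multiplication by \<open>n\<close> sends
  every residue orbit to a nonresidue orbit in such a way that the edges between the two form a
  perfect matching.\<close>

theorem exists_good_nonresidue:
  "\<exists>n\<in>K. legendre n = -1 \<and> legendre (1 - n) = 1 \<and> (\<forall>j\<in>{1..4}. legendre (1 - n * h ^ j) = -1)"
proof (cases "CHAR('a) \<le> 1707")
  case True then show ?thesis by (rule exists_good_nonresidue_of_small_char)
next
  case False
  then obtain t where "t \<in> nonresidues" "\<bar>\<Sum>j<5. sgn_at t j\<bar> = 3"
    using exists_orbit_sum_3_of_large_char by auto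
  then show ?thesis by (rule exists_good_nonresidue_of_orbit_sum_3)
qed

end

section \<open>Reduction to the prime field\<close>

lemma finite_field_power_order:
  fixes x :: "'a::finite_field"
  assumes "x \<noteq> 0" shows "x ^ (CARD('a) - 1) = 1"
proof -
  have "CARD('a) \<noteq> 0" by simp
  then have "x * x ^ (CARD('a) - 1) = x ^ CARD('a)" by (simp flip: power_Suc)
  then show ?thesis using assms by (simp add: finite_field_power_card_eq_same)
qed

text \<open>Otherwise the powers of \<open>\<alpha>\<close> would repeat after \<open>n\<close> steps, too early to exhaust the field.\<close>

lemma primitive_element_power_ne_1:
  fixes \<alpha> :: "'a::finite_field"
  assumes prim: "primitive_element \<alpha>" and n: "0 < n" "n < CARD('a) - 1"
  shows "\<alpha> ^ n \<noteq> 1"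
proof
  assume one: "\<alpha> ^ n = 1"
  have \<alpha>0: "\<alpha> \<noteq> 0" using prim by (simp add: primitive_element_def)
  have "UNIV - {0} \<subseteq> (\<lambda>i. \<alpha> ^ i) ` {..<n}"
  proof
    fix x :: 'a assume "x \<in> UNIV - {0}"
    then obtain k :: int where k: "x = \<alpha> powi k"
      using prim by (auto simp: primitive_element_def)
    have "x = \<alpha> powi (int n * (k div int n) + k mod int n)" by (simp add: k)
    also have "\<dots> = \<alpha> powi (int n * (k div int n)) * \<alpha> powi (k mod int n)"
      using \<alpha>0 by (intro power_int_add) simp
    also have "\<dots> = (\<alpha> powi int n) powi (k div int n) * \<alpha> powi (k mod int n)"
      by (simp only: power_int_mult)
    also have "\<dots> = \<alpha> powi (k mod int n)" by (simp add: one)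
    also have "\<dots> = \<alpha> ^ nat (k mod int n)" using n(1) by (simp add: power_int_def)
    finally show "x \<in> (\<lambda>i. \<alpha> ^ i) ` {..<n}"
      using n(1) by (auto simp: nat_less_iff)
  qed
  then have "card (UNIV - {0::'a}) \<le> card ((\<lambda>i. \<alpha> ^ i) ` {..<n})" by (intro card_mono) auto
  also have "\<dots> \<le> n" using card_image_le[of "{..<n}" "\<lambda>i. \<alpha> ^ i"] by simp
  finally show False using n(2) by (simp add: card_Diff_singleton)
qed

lemma quadratic_char_euler:
  fixes x :: "'a::finite_field"
  assumes q: "odd CARD('a)" and x: "x \<noteq> 0"
  shows "quadratic_char x = 1 \<longleftrightarrow> x ^ ((CARD('a) - 1) div 2) = 1"
proof -
  let ?m = "(CARD('a) - 1) div 2"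
  let ?S = "(\<lambda>d. d\<^sup>2) ` (UNIV - {0::'a})" and ?R = "{x. x ^ ?m = (1::'a)}"
  have m: "2 * ?m = CARD('a) - 1" using q by simp
  have "CARD('a) > 1" using card_mono[of "UNIV :: 'a set" "{0, 1}"] by simp
  then have m0: "?m > 0" using m by (cases "?m = 0") auto
  have eq: "?S = ?R"
    using m m0 finite_field_power_order
    by (intro squares_eq_half_power_kernel) (auto simp: card_Diff_singleton)
  have "quadratic_char x = 1 \<longleftrightarrow> x \<in> ?S"
    using x by (auto simp: quadratic_char_def)
  then show ?thesis unfolding eq by simp
qed

locale odd_field =
  fixes ty :: "'a::finite_field itself"
  assumes odd_card: "odd CARD('a)"
begin

lemma quadratic_char_cases: "x \<noteq> 0 \<Longrightarrow> quadratic_char x = 1 \<or> quadratic_char x = -1"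
  by (auto simp: quadratic_char_def)

lemma quadratic_char_0 [simp]: "quadratic_char 0 = 0"
  by (simp add: quadratic_char_def)

lemma quadratic_char_1 [simp]: "quadratic_char (1::'a) = 1"
  by (auto simp: quadratic_char_def intro: exI[of _ 1])

lemma half_power_cases:
  assumes "(x::'a) \<noteq> 0"
  shows "x ^ ((CARD('a) - 1) div 2) = 1 \<or> x ^ ((CARD('a) - 1) div 2) = -1"
proof -
  have "2 * ((CARD('a) - 1) div 2) = CARD('a) - 1" using odd_card by simp
  then have "(x ^ ((CARD('a) - 1) div 2))\<^sup>2 = 1"
    using finite_field_power_order[OF assms] by (simp flip: power_mult add: mult.commute)
  then show ?thesis by (simp add: power2_eq_1_iff)
qed

lemma one_ne_minus_one: "(1::'a) \<noteq> -1"
proof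
  assume "(1::'a) = -1"
  then have "(of_nat 2 :: 'a) = 0" by (simp add: eq_neg_iff_add_eq_0)
  then have "CHAR('a) dvd 2" by (simp only: of_nat_eq_0_iff_char_dvd)
  then have "CHAR('a) = 2" using primes_dvd_imp_eq[of "CHAR('a)" 2] by simp
  then show False using CHAR_dvd_CARD[where ?'a = 'a] odd_card by auto
qed

lemma quadratic_char_mult [simp]: "quadratic_char (x * y) = quadratic_char x * quadratic_char (y::'a)"
proof (cases "x = 0 \<or> y = 0")
  case False
  then show ?thesis
    using quadratic_char_euler[OF odd_card, of x] quadratic_char_euler[OF odd_card, of y]
      quadratic_char_euler[OF odd_card, of "x * y"] quadratic_char_cases[of x] quadratic_char_cases[of y]
      quadratic_char_cases[of "x * y"] half_power_cases[of x] half_power_cases[of y] one_ne_minus_one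
    by (auto simp: power_mult_distrib)
qed auto

lemma quadratic_char_power: "quadratic_char (x ^ n) = quadratic_char (x::'a) ^ n"
  by (induction n) auto

end

lemma minus_1_dvd_power_minus_1: "(x - 1) dvd (x ^ j - 1)" for x :: nat
proof (cases "x = 0")
  case False
  then have "x ^ Suc j - 1 = x * (x ^ j - 1) + (x - 1)" for j
    by (simp add: algebra_simps)
  then show ?thesis by (induction j) (simp_all del: power_Suc)
qed (cases j, auto)

text \<open>
  The hypothesis on \<open>1 + h\<close> leaves little room for \<open>q = p ^ n\<close>.  Up to the square \<open>h ^ 3\<close>, which is
  \<open>(h ^ 4)\<^sup>2\<close>, the element \<open>1 + h\<close> is \<open>s = h ^ 2 + h ^ 3\<close>, and \<open>s\<close> is fixed by Frobenius if \<open>p\<close> is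
  1 or 4 modulo 5, and by its square in any case.  If \<open>n\<close> is even, the subfield containing
  \<open>s\<close> has even codegree, so that \<open>s\<close> is a square: for \<open>p\<close> equal to 2 or 3 modulo 5 one needs here that
  4 divides \<open>n\<close>, since otherwise \<open>q\<close> is not 1 modulo 5.  Hence \<open>n\<close> is odd, and then the
  congruence for \<open>q\<close> descends to \<open>p\<close>.
\<close>
lemma char_of_nonsquare_one_plus_fifth_root:
  fixes h :: "'a::finite_field"
  assumes pp: "primepow CARD('a)" and q: "CARD('a) mod 20 = 1"
    and h5: "h ^ 5 = 1" and h1: "h \<noteq> 1" and nonsq: "quadratic_char (1 + h) = -1"
  obtains n where "CARD('a) = CHAR('a) ^ n" "odd n" "CHAR('a) mod 20 = 1" "h \<in> prime_subfield"
proof -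
  let ?p = "CHAR('a)" and ?q = "CARD('a)"
  define m where "m = (?q - 1) div 2"
  have "odd ?q" using q by presburger
  interpret odd_field "TYPE('a)" by unfold_locales fact
  have prime: "prime ?p" by simp
  obtain r n where rn: "prime r" "n > 0" "?q = r ^ n" using pp by (auto simp: primepow_def)
  have "?p dvd r ^ n" using CHAR_dvd_CARD[where ?'a = 'a] rn(3) by simp
  then have "r = ?p" using prime rn(1) by (metis prime_dvd_power_nat primes_dvd_imp_eq)
  then have qn: "?q = ?p ^ n" using rn by simp
  have oddp: "odd ?p" using \<open>odd ?q\<close> qn rn(2) by auto
  have q5: "?p ^ n mod 5 = 1" using mod_mod_cancel[of 5 20 ?q] q by (simp flip: qn)
  have q4: "?p ^ n mod 4 = 1" using mod_mod_cancel[of 4 20 ?q] q by (simp flip: qn)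
  note hmod = fifth_root_power_mod[OF h5]
  have h0: "h \<noteq> 0" using h5 by auto
  define s where "s = h ^ 2 + h ^ 3"
  have "(h ^ 3)\<^sup>2 = h" using hmod[of 6] by (simp flip: power_mult)
  then have qh: "quadratic_char h = 1" using h0 unfolding quadratic_char_def by metis
  have "h ^ 3 * s = 1 + h"
    using h5 hmod[of 6] by (simp add: s_def distrib_left flip: power_add)
  then have "quadratic_char (h ^ 3 * s) = -1" using nonsq by simp
  then have qs: "quadratic_char s = -1" by (simp add: quadratic_char_power qh)
  have s0: "s \<noteq> 0" using qs by auto
  have sm: "s ^ m \<noteq> 1" using quadratic_char_euler[OF odd_card s0] qs by (simp add: m_def)
  have frob: "s ^ (?p ^ j) = h ^ (2 * ?p ^ j mod 5) + h ^ (3 * ?p ^ j mod 5)" for j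
  proof -
    have "s ^ (?p ^ j) = (h ^ 2) ^ (?p ^ j) + (h ^ 3) ^ (?p ^ j)"
      unfolding s_def by (rule freshmans_dream') auto
    then show ?thesis by (simp only: hmod power_mult)
  qed
  \<comment> \<open>An element of a subfield of order \<open>x\<close> is a square if \<open>(q - 1) / (x - 1)\<close> is even.\<close>
  have trivial: "s ^ m = 1" if fixed: "s ^ x = s" and x: "x > 0" "2 * (x - 1) dvd ?q - 1" for x
  proof -
    have "s * s ^ (x - 1) = s" using fixed x(1) by (simp flip: power_Suc)
    then have "s ^ (x - 1) = 1" using s0 by simp
    moreover have "(x - 1) dvd m" using x(2) \<open>odd ?q\<close> by (auto simp: m_def elim!: dvdE)
    ultimately show ?thesis by (auto elim!: dvdE simp: power_mult)
  qed
  have p5: "?p mod 5 = 1 \<or> ?p mod 5 = 2 \<or> ?p mod 5 = 3 \<or> ?p mod 5 = 4"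
  proof -
    have "?p mod 5 \<noteq> 0" using q5 rn(2) by (metis mod_0 power_0_left power_mod not_gr0 zero_neq_one)
    then show ?thesis by presburger
  qed
  have pow_mod: "?p ^ k mod 5 = (?p mod 5) ^ k mod 5" "?p ^ k mod 4 = (?p mod 4) ^ k mod 4" for k
    by (simp_all add: power_mod)
  have mult_mod: "a * b mod 5 = a * (b mod 5) mod 5" for a b :: nat
    by (simp add: mod_mult_right_eq)
  have "odd n"
  proof
    assume "even n"
    then obtain j where j: "n = 2 * j" by (elim evenE)
    have dvd: "?p ^ 2 - 1 dvd ?q - 1"
      using minus_1_dvd_power_minus_1[of "?p ^ 2" j] by (simp add: qn j power_mult)
    have two: "even (?p + 1)" using oddp by simp
    show False
    proof (cases "?p mod 5 = 1 \<or> ?p mod 5 = 4")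
      case True
      have "(2 * x) mod 5 = 2 \<and> (3 * x) mod 5 = 3 \<or> (2 * x) mod 5 = 3 \<and> (3 * x) mod 5 = 2"
        if "x mod 5 = 1 \<or> x mod 5 = 4" for x :: nat
        using that mult_mod[of 2 x] mult_mod[of 3 x] by auto
      from this[OF True] have "s ^ ?p = s" using frob[of 1] by (auto simp: s_def add.commute)
      moreover have "2 * (?p - 1) dvd ?p ^ 2 - 1"
      proof -
        have "?p ^ 2 - 1 = (?p + 1) * (?p - 1)" by (simp add: power2_eq_square algebra_simps)
        then show ?thesis using mult_dvd_mono[OF two dvd_refl, of "?p - 1"] by (simp only:)
      qed
      ultimately show False using trivial[of ?p] dvd sm by (auto intro: dvd_trans)
    next
      case False
      then have p2: "?p ^ 2 mod 5 = 4" using p5 pow_mod(1)[of 2] by auto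
      have "(2 * x) mod 5 = 3 \<and> (3 * x) mod 5 = 2" if "x mod 5 = 4" for x :: nat
        using that mult_mod[of 2 x] mult_mod[of 3 x] by simp
      from this[OF p2] have fixed: "s ^ (?p ^ 2) = s" using frob[of 2] by (simp add: s_def add.commute)
      have "even j"
      proof (rule ccontr)
        assume "odd j"
        then obtain i where i: "j = 2 * i + 1" by (elim oddE)
        have "?p ^ n = (?p ^ 2) ^ j" by (simp add: j power_mult)
        then have "?p ^ n mod 5 = 4 ^ j mod 5" using p2 by (metis power_mod)
        also have "\<dots> = (4 ^ 2) ^ i * 4 mod 5" by (simp only: i power_add power_mult power_one_right)
        also have "\<dots> = ((4 ^ 2) mod 5) ^ i * 4 mod 5" by (metis mod_mult_left_eq power_mod)
        also have "\<dots> = 4" by simp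
        finally show False using q5 by simp
      qed
      then obtain i where i: "j = 2 * i" by (elim evenE)
      have "?p ^ 4 - 1 dvd ?q - 1"
        using minus_1_dvd_power_minus_1[of "?p ^ 4" i] by (simp add: qn j i flip: power_mult)
      moreover have "2 * (?p ^ 2 - 1) dvd ?p ^ 4 - 1"
      proof -
        have "?p ^ 4 - 1 = (?p ^ 2 + 1) * (?p ^ 2 - 1)" by (simp add: algebra_simps flip: power_add)
        moreover have "even (?p ^ 2 + 1)" using oddp by simp
        ultimately show ?thesis
          using mult_dvd_mono[of 2 "?p ^ 2 + 1" "?p ^ 2 - 1", OF _ dvd_refl] by (simp only:)
      qed
      ultimately have "2 * (?p ^ 2 - 1) dvd ?q - 1" by (rule dvd_trans[rotated])
      then show False using trivial[OF fixed] sm by simp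
    qed
  qed
  then obtain j where j: "n = 2 * j + 1" by (elim oddE)
  have sq_mod: "?p ^ n mod k = (?p ^ 2 mod k) ^ j * (?p mod k) mod k" for k
  proof -
    have "a * (b mod k) mod k = (a mod k) * b mod k" for a b
      by (simp add: mod_simps)
    then have "(?p ^ 2 mod k) ^ j * (?p mod k) mod k = ((?p ^ 2 mod k) ^ j mod k) * ?p mod k" .
    also have "\<dots> = ((?p ^ 2) ^ j mod k) * ?p mod k" by (simp only: power_mod)
    finally show ?thesis by (simp only: j power_add power_mult power_one_right mod_simps)
  qed
  have p_mod_5: "?p mod 5 = 1"
  proof -
    consider "?p ^ 2 mod 5 = 1" | "?p ^ 2 mod 5 = 4" using p5 pow_mod(1)[of 2] by auto
    then show ?thesis
    proof cases
      case 1 then show ?thesis using sq_mod[of 5] q5 by simp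
    next
      case 2
      then have p23: "?p mod 5 = 2 \<or> ?p mod 5 = 3" using p5 pow_mod(1)[of 2] by auto
      have "4 ^ j mod 5 = (1::nat) \<or> 4 ^ j mod 5 = (4::nat)"
      proof (induction j)
        case (Suc j) then show ?case using mult_mod[of 4 "4 ^ j"] by auto
      qed simp
      then have "4 ^ j * (?p mod 5) mod 5 \<noteq> 1"
        using p23 mod_mult_left_eq[of "4 ^ j" 5 "?p mod 5"] by auto
      then show ?thesis using sq_mod[of 5] q5 2 by simp
    qed
  qed
  have p_mod_4: "?p mod 4 = 1"
  proof -
    have "?p mod 4 = 1 \<or> ?p mod 4 = 3" using oddp by presburger
    then have "?p ^ 2 mod 4 = 1" using pow_mod(2)[of 2] by auto
    then show ?thesis using sq_mod[of 4] q4 by simp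
  qed
  have "[?p = 1] (mod 5)" "[?p = 1] (mod 4)" using p_mod_5 p_mod_4 by (simp_all add: cong_def)
  then have "[?p = 1] (mod 5 * 4)" 
    by (rule coprime_cong_mult_nat) (use coprime_Suc_left_nat[of 4] in simp)
  then have "?p mod 20 = 1" by (simp add: cong_def)
  moreover have "h \<in> prime_subfield"
    using hmod[of ?p] p_mod_5 by (simp add: prime_subfield_def)
  ultimately show ?thesis using that qn \<open>odd n\<close> by blast
qed

text \<open>The exponent \<open>(q - 1) / 2\<close> is \<open>(p - 1) / 2\<close> times \<open>1 + p + \<dots> + p ^ (n - 1)\<close>, which is odd.\<close>

lemma (in odd_char) quadratic_char_eq_legendre:
  assumes q: "CARD('a) = CHAR('a) ^ n" and n: "odd n" and x: "x \<in> K"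
  shows "quadratic_char x = legendre x"
proof (cases "x = 0")
  case False
  let ?p = "CHAR('a)"
  have oddq: "odd CARD('a)" using q odd_char by simp
  define N where "N = (\<Sum>i<n. ?p ^ i)"
  have "odd (\<Sum>i<k. ?p ^ i) \<longleftrightarrow> odd k" for k
    using odd_char by (induction k) auto
  then have "odd N" using n by (simp add: N_def)
  have "?p ^ n - 1 = (?p - 1) * N"
  proof -
    have "(\<Sum>i<k. ?p ^ i) * (?p - 1) + 1 = ?p ^ k" for k
    proof (induction k)
      case (Suc k)
      have "?p = ?p - 1 + 1" using prime_gt_1_nat[of ?p] by simp
      then have "?p ^ Suc k = (?p - 1) * ?p ^ k + ?p ^ k" by (metis add_mult_distrib mult_1 power_Suc)
      then show ?case using Suc by (simp add: algebra_simps)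
    qed simp
    from this[of n] show ?thesis by (simp add: N_def mult.commute)
  qed
  then have "CARD('a) - 1 = 2 * (((?p - 1) div 2) * N)"
    using char_eq q by (metis diff_add_inverse2 mult.assoc)
  then have m: "(CARD('a) - 1) div 2 = (?p - 1) div 2 * N" by simp
  have "x ^ ((CARD('a) - 1) div 2) = (x ^ ((?p - 1) div 2)) ^ N"
    by (simp only: m power_mult)
  also have "\<dots> = x ^ ((?p - 1) div 2)"
    using half_power[OF x False] \<open>odd N\<close> by auto
  finally have "quadratic_char x = 1 \<longleftrightarrow> legendre x = 1"
    using quadratic_char_euler[OF oddq False] legendre_eq_iff(2)[OF x] by simp
  then show ?thesis using False by (auto simp: quadratic_char_def legendre_def split: if_splits)
qed (simp add: quadratic_char_def legendre_def)

section \<open>Induced subgraphs and the Petersen graph\<close>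

lemma petersen_arcs:
  "(Inl i, Inl j) \<in> parcs petersen_graph \<longleftrightarrow> i < 5 \<and> j < 5 \<and> (j = (i + 1) mod 5 \<or> i = (j + 1) mod 5)"
  "(Inr i, Inr j) \<in> parcs petersen_graph \<longleftrightarrow> i < 5 \<and> j < 5 \<and> (j = (i + 2) mod 5 \<or> i = (j + 2) mod 5)"
  "(Inl i, Inr j) \<in> parcs petersen_graph \<longleftrightarrow> i < 5 \<and> i = j"
  "(Inr i, Inl j) \<in> parcs petersen_graph \<longleftrightarrow> i < 5 \<and> i = j"
  by (auto simp: petersen_graph_def generalized_petersen_def Let_def)

lemma petersen_verts: "pverts petersen_graph = Inl ` {..<5} \<union> Inr ` {..<5}"
  by (simp add: petersen_graph_def generalized_petersen_def Let_def)

lemma petersen_triangle_free: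
  assumes "(A, B) \<in> parcs petersen_graph" "(B, C) \<in> parcs petersen_graph" "(A, C) \<in> parcs petersen_graph"
  shows False
proof -
  have below_5: "i \<in> {0, 1, 2, 3, 4}" if "i < 5" for i :: nat
    using that by auto
  have outer: False if "i < 5" "j < 5" "k < 5" "j = (i + 1) mod 5 \<or> i = (j + 1) mod 5"
    "k = (j + 1) mod 5 \<or> j = (k + 1) mod 5" "k = (i + 1) mod 5 \<or> i = (k + 1) mod 5" for i j k :: nat
  proof -
    have "\<forall>i\<in>{0, 1, 2, 3, 4}. \<forall>j\<in>{0, 1, 2, 3, 4}. \<forall>k\<in>{0, 1, 2, 3, 4 :: nat}.
        \<not> ((j = (i + 1) mod 5 \<or> i = (j + 1) mod 5) \<and> (k = (j + 1) mod 5 \<or> j = (k + 1) mod 5)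
          \<and> (k = (i + 1) mod 5 \<or> i = (k + 1) mod 5))"
      by simp
    from bspec[OF bspec[OF bspec[OF this below_5[OF that(1)]] below_5[OF that(2)]] below_5[OF that(3)]]
    show ?thesis using that(4-6) by blast
  qed
  have inner: False if "i < 5" "j < 5" "k < 5" "j = (i + 2) mod 5 \<or> i = (j + 2) mod 5"
    "k = (j + 2) mod 5 \<or> j = (k + 2) mod 5" "k = (i + 2) mod 5 \<or> i = (k + 2) mod 5" for i j k :: nat
  proof -
    have "\<forall>i\<in>{0, 1, 2, 3, 4}. \<forall>j\<in>{0, 1, 2, 3, 4}. \<forall>k\<in>{0, 1, 2, 3, 4 :: nat}.
        \<not> ((j = (i + 2) mod 5 \<or> i = (j + 2) mod 5) \<and> (k = (j + 2) mod 5 \<or> j = (k + 2) mod 5)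
          \<and> (k = (i + 2) mod 5 \<or> i = (k + 2) mod 5))"
      by simp
    from bspec[OF bspec[OF bspec[OF this below_5[OF that(1)]] below_5[OF that(2)]] below_5[OF that(3)]]
    show ?thesis using that(4-6) by blast
  qed
  have loop: "i \<noteq> (i + 1) mod 5" "i \<noteq> (i + 2) mod 5" for i :: nat by presburger+
  show False
    using assms loop outer inner
    by (cases A; cases B; cases C) (simp_all only: petersen_arcs, blast+)
qed

lemma paley_arc: "(u, v) \<in> parcs paley_graph \<longleftrightarrow> quadratic_char (u - v) = 1"
  by (auto simp: paley_graph_def quadratic_char_def)

text \<open>In an induced Paley graph it is enough to label the vertices as an outer and an inner
  pentagon and to compare adjacency; the map on arcs is determined by that on vertices.\<close>

lemma digraph_iso_petersenI:
  fixes x y :: "nat \<Rightarrow> 'a::finite_field"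
  assumes inj: "inj_on x {..<5}" "inj_on y {..<5}" and dis: "x ` {..<5} \<inter> y ` {..<5} = {}"
    and out: "\<And>i j. i < 5 \<Longrightarrow> j < 5 \<Longrightarrow>
      quadratic_char (x i - x j) = 1 \<longleftrightarrow> j = (i + 1) mod 5 \<or> i = (j + 1) mod 5"
    and inn: "\<And>i j. i < 5 \<Longrightarrow> j < 5 \<Longrightarrow>
      quadratic_char (y i - y j) = 1 \<longleftrightarrow> j = (i + 2) mod 5 \<or> i = (j + 2) mod 5"
    and spoke: "\<And>i j. i < 5 \<Longrightarrow> j < 5 \<Longrightarrow> quadratic_char (x i - y j) = 1 \<longleftrightarrow> i = j"
      "\<And>i j. i < 5 \<Longrightarrow> j < 5 \<Longrightarrow> quadratic_char (y i - x j) = 1 \<longleftrightarrow> i = j"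
  shows "digraph_iso (with_proj paley_graph \<restriction> (x ` {..<5} \<union> y ` {..<5})) (with_proj petersen_graph)"
proof -
  define f where "f = case_sum x y"
  define hom where "hom = \<lparr>iso_verts = f, iso_arcs = map_prod f f, iso_head = snd, iso_tail = fst\<rparr>"
  let ?V = "pverts petersen_graph" and ?A = "parcs petersen_graph"
  let ?G = "with_proj paley_graph \<restriction> (x ` {..<5} \<union> y ` {..<5})"
  interpret P: pair_graph petersen_graph by (rule pair_graph_petersen)
  have "x i \<noteq> y j" if "i < 5" "j < 5" for i j using dis that by blast
  then have injf: "inj_on f ?V"
    using inj by (auto simp: petersen_verts f_def inj_on_def) metis
  have sub: "?A \<subseteq> ?V \<times> ?V"
    using P.in_arcsD1 P.in_arcsD2 by auto
  have adj: "quadratic_char (f a - f b) = 1 \<longleftrightarrow> (a, b) \<in> ?A" if "a \<in> ?V" "b \<in> ?V" for a b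
    using that by (auto simp: petersen_verts f_def petersen_arcs out inn spoke)
  have image: "f ` ?V = x ` {..<5} \<union> y ` {..<5}"
    by (simp add: petersen_verts f_def image_Un image_image)
  have hom: "pre_digraph.digraph_isomorphism (with_proj petersen_graph) hom"
    unfolding pre_digraph.digraph_isomorphism_def
  proof (intro conjI)
    show "wf_digraph (with_proj petersen_graph)" by unfold_locales
    show "inj_on (iso_verts hom) (verts (with_proj petersen_graph))"
      using injf by (simp add: hom_def)
    show "inj_on (iso_arcs hom) (arcs (with_proj petersen_graph))"
      using inj_on_subset[OF map_prod_inj_on[OF injf injf] sub] by (simp add: hom_def)
  qed (auto simp: hom_def)
  have "arcs ?G = map_prod f f ` ?A"
  proof (intro equalityI subsetI)
    fix e assume "e \<in> arcs ?G"
    then have e: "e \<in> parcs paley_graph" "fst e \<in> f ` ?V" "snd e \<in> f ` ?V" by (auto simp: image)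
    then obtain a b where "fst e = f a" "snd e = f b" "a \<in> ?V" "b \<in> ?V" by blast
    then have eq: "e = map_prod f f (a, b)" and ab: "a \<in> ?V" "b \<in> ?V" by (auto simp: prod_eq_iff)
    then show "e \<in> map_prod f f ` ?A" using e(1) adj[OF ab] by (auto simp: paley_arc)
  next
    fix e assume "e \<in> map_prod f f ` ?A"
    then obtain a b where ab: "(a, b) \<in> ?A" "e = (f a, f b)" by auto
    then have V: "a \<in> ?V" "b \<in> ?V" using sub by auto
    then have "f a \<in> f ` ?V" "f b \<in> f ` ?V" by auto
    then show "e \<in> arcs ?G" using ab adj[OF V] by (simp add: paley_arc flip: image)
  qed
  then have "app_iso hom (with_proj petersen_graph) = ?G"
    by (intro pre_digraph.equality) (auto simp: hom_def image paley_graph_def)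
  with hom have "digraph_iso (with_proj petersen_graph) ?G"
    unfolding digraph_iso_def by metis
  then show ?thesis
    by (rule digraph_iso_swap[rotated]) unfold_locales
qed

lemma digraph_iso_petersen_triangle_free:
  assumes iso: "digraph_iso (with_proj paley_graph \<restriction> S) (with_proj petersen_graph)"
    and mem: "u \<in> S" "v \<in> S" "w \<in> S"
    and adj: "quadratic_char (u - v) = 1" "quadratic_char (v - w) = 1" "quadratic_char (u - w) = 1"
  shows False
proof -
  let ?G = "with_proj paley_graph \<restriction> S"
  obtain f where f: "pre_digraph.digraph_isomorphism ?G f" and eq: "with_proj petersen_graph = app_iso f ?G"
    using iso by (auto simp: digraph_iso_def)
  have ends: "iso_tail f = fst" "iso_head f = snd"
    using arg_cong[OF eq, of tail] arg_cong[OF eq, of head] by simp_all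
  have arcs: "parcs petersen_graph = iso_arcs f ` arcs ?G"
    using arg_cong[OF eq, of arcs] by simp
  have "(iso_verts f a, iso_verts f b) \<in> parcs petersen_graph"
    if "a \<in> S" "b \<in> S" "quadratic_char (a - b) = 1" for a b
  proof -
    have ab: "(a, b) \<in> arcs ?G" using that by (simp add: paley_arc)
    then have "iso_verts f a = fst (iso_arcs f (a, b))" "iso_verts f b = snd (iso_arcs f (a, b))"
      using f unfolding pre_digraph.digraph_isomorphism_def by (auto simp: ends)
    then show ?thesis using ab by (simp add: arcs)
  qed
  from petersen_triangle_free[OF this[OF mem(1,2) adj(1)] this[OF mem(2,3) adj(2)] this[OF mem(1,3) adj(3)]]
  show False .
qed

section \<open>Pairing the orbits\<close>

text \<open>Adjacency between \<open>r * h ^ i\<close> and \<open>r * h ^ j\<close> depends only on the difference \<open>d\<close> of the exponents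
  modulo 5, which determines the position of \<open>i\<close> and \<open>j\<close> on the outer and on the inner pentagon.\<close>

lemma cyclic_distance:
  assumes "i < 5" "j < (5::nat)"
  obtains d where "d < 5" "j = (i + d) mod 5" "i = j \<longleftrightarrow> d = 0"
    "j = (i + 1) mod 5 \<or> i = (j + 1) mod 5 \<longleftrightarrow> d = 1 \<or> d = 4"
    "j = (i + 2) mod 5 \<or> i = (j + 2) mod 5 \<longleftrightarrow> d = 2 \<or> d = 3"
proof -
  define d where "d = (j + (5 - i)) mod 5"
  have below_5: "k \<in> {0, 1, 2, 3, 4}" if "k < 5" for k :: nat using that by auto
  have "\<forall>i\<in>{0, 1, 2, 3, 4 :: nat}. \<forall>j\<in>{0, 1, 2, 3, 4}. \<forall>d\<in>{(j + (5 - i)) mod 5}.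
      j = (i + d) mod 5 \<and> (i = j \<longleftrightarrow> d = 0)
      \<and> (j = (i + 1) mod 5 \<or> i = (j + 1) mod 5 \<longleftrightarrow> d = 1 \<or> d = 4)
      \<and> (j = (i + 2) mod 5 \<or> i = (j + 2) mod 5 \<longleftrightarrow> d = 2 \<or> d = 3)"
    by simp
  moreover have "d \<in> {(j + (5 - i)) mod 5}" "d < 5" by (simp_all add: d_def)
  ultimately show ?thesis
    using that[of d] below_5[OF assms(1)] below_5[OF assms(2)] by metis
qed

lemma powers_eq_image: "{1, h, h ^ 2, h ^ 3, h ^ 4} = (\<lambda>i. h ^ i) ` {..<5}" for h :: "'a::monoid_mult"
  by (simp add: lessThan_5)

lemma scaled_coset: "(*) a ` (*) b ` H = (*) (a * b) ` H" for a b :: "'a::field"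
  by (simp add: image_image mult.assoc)

locale square_fifth_root = odd_field ty for ty :: "'a::finite_field itself" +
  fixes h :: 'a
  assumes h5: "h ^ 5 = 1" and minus_1_square: "quadratic_char (-1::'a) = 1"
begin

lemma quadratic_char_uminus: "quadratic_char (- x) = quadratic_char (x::'a)"
  using quadratic_char_mult[of "-1" x] by (simp add: minus_1_square del: quadratic_char_mult)

lemma h_nonzero: "h \<noteq> 0"
  using h5 by auto

lemma h_power_mod: "h ^ (k mod 5) = h ^ k"
  using h5 by (rule fifth_root_power_mod)

lemma quadratic_char_h: "quadratic_char h = 1"
proof -
  have "(h ^ 3)\<^sup>2 = h" using h_power_mod[of 6] by (simp flip: power_mult)
  then show ?thesis using h_nonzero unfolding quadratic_char_def by metis
qed

lemma one_in_residue_orbits: "{1, h, h ^ 2, h ^ 3, h ^ 4} \<in> residue_orbits {1, h, h ^ 2, h ^ 3, h ^ 4}"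
proof -
  have "{1, h, h ^ 2, h ^ 3, h ^ 4} = (*) 1 ` {1, h, h ^ 2, h ^ 3, h ^ 4}" "(1::'a) \<noteq> 0" by simp_all
  then have "{1, h, h ^ 2, h ^ 3, h ^ 4} \<in> mult_cosets {1, h, h ^ 2, h ^ 3, h ^ 4}"
    unfolding mult_cosets_def by blast
  then show ?thesis
    unfolding residue_orbits_def by (simp add: quadratic_char_power quadratic_char_h)
qed

text \<open>If \<open>1 + h\<close> is a square, then \<open>1 - h\<close> and \<open>1 - h ^ 2\<close> have the same character value \<open>\<epsilon>\<close>.  The
  triangle \<open>b, b * h, b * h ^ 2\<close> lies in every residue orbit if \<open>\<epsilon> = 1\<close> and in every nonresidue
  orbit if \<open>\<epsilon> = -1\<close>, but the Petersen graph has no triangle.\<close>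

lemma not_partitionable:
  assumes "quadratic_char (1 + h) = 1" and h1: "h \<noteq> 1"
  shows "\<not> G52_partitionable {1, h, h ^ 2, h ^ 3, h ^ 4}"
proof
  let ?H = "{1, h, h ^ 2, h ^ 3, h ^ 4}"
  assume "G52_partitionable ?H"
  then obtain \<phi> where \<phi>: "bij_betw \<phi> (residue_orbits ?H) (nonresidue_orbits ?H)"
    and iso: "\<And>R. R \<in> residue_orbits ?H \<Longrightarrow>
      digraph_iso (with_proj paley_graph \<restriction> (R \<union> \<phi> R)) (with_proj petersen_graph)"
    unfolding G52_partitionable_def by blast
  have "\<phi> ?H \<in> nonresidue_orbits ?H"
    using bij_betwE[OF \<phi>] one_in_residue_orbits by blast
  then obtain a where a: "\<phi> ?H = (*) a ` ?H" "\<forall>x\<in>\<phi> ?H. quadratic_char x = -1"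
    by (auto simp: nonresidue_orbits_def mult_cosets_def)
  then have qa: "quadratic_char a = -1" by auto
  have triangle: "quadratic_char (b * 1 - b * h) = 1 \<and> quadratic_char (b * h - b * h ^ 2) = 1
      \<and> quadratic_char (b * 1 - b * h ^ 2) = 1"
    if "quadratic_char b * quadratic_char (1 - h) = 1" for b
  proof -
    have "b * 1 - b * h = b * (1 - h)" "b * h - b * h ^ 2 = h * (b * (1 - h))"
      "b * 1 - b * h ^ 2 = b * (1 - h) * (1 + h)"
      by (simp_all add: algebra_simps power2_eq_square)
    then show ?thesis using that assms(1) quadratic_char_h by simp
  qed
  have "\<exists>b. b * 1 \<in> ?H \<union> \<phi> ?H \<and> b * h \<in> ?H \<union> \<phi> ?H \<and> b * h ^ 2 \<in> ?H \<union> \<phi> ?H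
      \<and> quadratic_char b * quadratic_char (1 - h) = 1"
  proof (cases "quadratic_char (1 - h) = 1")
    case True
    then show ?thesis by (intro exI[of _ 1]) simp
  next
    case False
    then have "quadratic_char (1 - h) = -1" using quadratic_char_cases[of "1 - h"] h1 by auto
    then show ?thesis using qa a(1) by (intro exI[of _ a]) simp
  qed
  then obtain b where b: "b * 1 \<in> ?H \<union> \<phi> ?H" "b * h \<in> ?H \<union> \<phi> ?H" "b * h ^ 2 \<in> ?H \<union> \<phi> ?H"
    "quadratic_char b * quadratic_char (1 - h) = 1" by blast
  from triangle[OF b(4)] show False
    using digraph_iso_petersen_triangle_free[OF iso[OF one_in_residue_orbits] b(1,2,3)] by blast
qed

text \<open>If \<open>1 + h\<close> is a nonsquare, then \<open>1 - h\<close> and \<open>1 - h ^ 2\<close> have opposite character values.  So in one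
  of the orbits \<open>R\<close> and \<open>n * R\<close> the elements at cyclic distance one are adjacent, in the other
  those at distance two.  These are the two pentagons of the Petersen graph, and the
  hypothesis on \<open>n\<close> provides the spokes.\<close>

lemma partitionable:
  assumes nonsq: "quadratic_char (1 + h) = -1"
    and n: "quadratic_char n = -1" "quadratic_char (1 - n) = 1"
    and n': "\<And>j. j \<in> {1..4} \<Longrightarrow> quadratic_char (1 - n * h ^ j) = -1"
  shows "G52_partitionable {1, h, h ^ 2, h ^ 3, h ^ 4}"
  unfolding G52_partitionable_def
proof (intro exI conjI ballI)
  let ?H = "{1, h, h ^ 2, h ^ 3, h ^ 4}"
  have n0: "n \<noteq> 0" using n(1) by auto
  have qn': "quadratic_char (inverse n) = -1"
    using quadratic_char_mult[of n "inverse n"] n0 n(1) by (simp del: quadratic_char_mult)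
  have to_non: "(*) n ` R \<in> nonresidue_orbits ?H" if R: "R \<in> residue_orbits ?H" for R
  proof -
    obtain a where "a \<noteq> 0" "R = (*) a ` ?H" "\<forall>x\<in>R. quadratic_char x = 1"
      using R by (auto simp: residue_orbits_def mult_cosets_def)
    then have "(*) n ` R = (*) (n * a) ` ?H" "n * a \<noteq> 0" "\<forall>x\<in>(*) n ` R. quadratic_char x = -1"
      using n0 n(1) by (simp_all only: scaled_coset) auto
    then show ?thesis unfolding nonresidue_orbits_def mult_cosets_def by blast
  qed
  have to_res: "(*) (inverse n) ` N \<in> residue_orbits ?H" if N: "N \<in> nonresidue_orbits ?H" for N
  proof -
    obtain a where "a \<noteq> 0" "N = (*) a ` ?H" "\<forall>x\<in>N. quadratic_char x = -1"
      using N by (auto simp: nonresidue_orbits_def mult_cosets_def)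
    then have "(*) (inverse n) ` N = (*) (inverse n * a) ` ?H" "inverse n * a \<noteq> 0"
      "\<forall>x\<in>(*) (inverse n) ` N. quadratic_char x = 1"
      using n0 qn' by (simp_all only: scaled_coset) auto
    then show ?thesis unfolding residue_orbits_def mult_cosets_def by blast
  qed
  show "bij_betw (\<lambda>R. (*) n ` R) (residue_orbits ?H) (nonresidue_orbits ?H)"
    by (rule bij_betw_byWitness[where f' = "\<lambda>N. (*) (inverse n) ` N"])
      (use to_non to_res n0 in \<open>auto simp: image_image mult.assoc[symmetric]\<close>)
  fix R assume "R \<in> residue_orbits ?H"
  then obtain r where r0: "r \<noteq> 0" and R: "R = (*) r ` ?H" and "\<forall>x\<in>R. quadratic_char x = 1"
    by (auto simp: residue_orbits_def mult_cosets_def)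
  then have r: "quadratic_char r = 1" by auto
  define x where "x i = r * h ^ i" for i :: nat
  define y where "y i = n * r * h ^ i" for i :: nat
  \<comment> \<open>The sign \<open>\<epsilon>\<close> decides whether \<open>R\<close> is the outer or the inner pentagon.\<close>
  define \<epsilon> where "\<epsilon> = quadratic_char (1 - h)"
  have img: "R = x ` {..<5}" "(*) n ` R = y ` {..<5}"
    unfolding R powers_eq_image by (simp_all add: x_def y_def image_image mult.assoc)
  have h1: "h \<noteq> 1"
  proof
    assume "h = 1"
    then have "quadratic_char (1 - n * h ^ 1) = 1" using n(2) by simp
    then show False using n'[of 1] by simp
  qed
  then have \<epsilon>: "\<epsilon> = 1 \<or> \<epsilon> = -1" using quadratic_char_cases[of "1 - h"] by (simp add: \<epsilon>_def)
  have D: "quadratic_char (1 - h ^ d) = (if d = 0 then 0 else if d = 1 \<or> d = 4 then \<epsilon> else - \<epsilon>)"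
    if "d < 5" for d :: nat
  proof -
    have "1 - h ^ 2 = (1 - h) * (1 + h)" "1 - h ^ 3 = - (h ^ 3 * ((1 - h) * (1 + h)))"
      "1 - h ^ 4 = - (h ^ 4 * (1 - h))"
      using h5 by (simp_all add: algebra_simps eval_nat_numeral)
    then have "quadratic_char (1 - h ^ 2) = - \<epsilon>" "quadratic_char (1 - h ^ 3) = - \<epsilon>"
      "quadratic_char (1 - h ^ 4) = \<epsilon>"
      by (simp_all add: quadratic_char_uminus quadratic_char_power quadratic_char_h \<epsilon>_def nonsq)
    moreover have "d = 0 \<or> d = 1 \<or> d = 2 \<or> d = 3 \<or> d = 4" using that by auto
    ultimately show ?thesis by (auto simp: \<epsilon>_def)
  qed
  have nd: "quadratic_char (1 - n * h ^ d) = 1 \<longleftrightarrow> d = 0" if "d < 5" for d :: nat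
    using that n(2) n'[of d] by (cases "d = 0") auto
  have xx: "quadratic_char (x i - x ((i + d) mod 5)) = quadratic_char (1 - h ^ d)" for i d
  proof -
    have "x i - x ((i + d) mod 5) = r * h ^ i * (1 - h ^ d)"
      by (simp add: x_def h_power_mod power_add algebra_simps)
    then show ?thesis by (simp add: r quadratic_char_power quadratic_char_h)
  qed
  have yy: "quadratic_char (y i - y j) = - quadratic_char (x i - x j)" for i j
  proof -
    have "y i - y j = n * (x i - x j)" by (simp add: x_def y_def algebra_simps)
    then show ?thesis by (simp add: n(1))
  qed
  then have yy_iff: "quadratic_char (y i - y j) = c \<longleftrightarrow> quadratic_char (x i - x j) = - c" for i j c
    by auto
  have xy: "quadratic_char (x i - y ((i + d) mod 5)) = quadratic_char (1 - n * h ^ d)" for i d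
  proof -
    have "x i - y ((i + d) mod 5) = r * h ^ i * (1 - n * h ^ d)"
      by (simp add: x_def y_def h_power_mod power_add algebra_simps)
    then show ?thesis by (simp add: r quadratic_char_power quadratic_char_h)
  qed
  have X1: "quadratic_char (x i - x j) = \<epsilon> \<longleftrightarrow> j = (i + 1) mod 5 \<or> i = (j + 1) mod 5"
    and X2: "quadratic_char (x i - x j) = - \<epsilon> \<longleftrightarrow> j = (i + 2) mod 5 \<or> i = (j + 2) mod 5"
    and XY: "quadratic_char (x i - y j) = 1 \<longleftrightarrow> i = j"
    and X0: "quadratic_char (x i - x j) = 0 \<longleftrightarrow> i = j" if ij: "i < 5" "j < 5" for i j
  proof -
    obtain d where d: "d < 5" "j = (i + d) mod 5" "i = j \<longleftrightarrow> d = 0"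
      "j = (i + 1) mod 5 \<or> i = (j + 1) mod 5 \<longleftrightarrow> d = 1 \<or> d = 4"
      "j = (i + 2) mod 5 \<or> i = (j + 2) mod 5 \<longleftrightarrow> d = 2 \<or> d = 3"
      using cyclic_distance[OF ij] by blast
    have val: "quadratic_char (x i - x j) = (if d = 0 then 0 else if d = 1 \<or> d = 4 then \<epsilon> else - \<epsilon>)"
      using xx[of i d] D[OF d(1)] by (simp only: d(2))
    have cases: "d = 0 \<or> d = 1 \<or> d = 2 \<or> d = 3 \<or> d = 4" using d(1) by auto
    show "quadratic_char (x i - x j) = \<epsilon> \<longleftrightarrow> j = (i + 1) mod 5 \<or> i = (j + 1) mod 5"
      unfolding d(4) val using \<epsilon> cases by auto
    show "quadratic_char (x i - x j) = - \<epsilon> \<longleftrightarrow> j = (i + 2) mod 5 \<or> i = (j + 2) mod 5"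
      unfolding d(5) val using \<epsilon> cases by auto
    show "quadratic_char (x i - x j) = 0 \<longleftrightarrow> i = j"
      unfolding d(3) val using \<epsilon> by auto
    show "quadratic_char (x i - y j) = 1 \<longleftrightarrow> i = j"
      using xy[of i d] nd[OF d(1)] d(3) by (simp only: d(2))
  qed
  have YX: "quadratic_char (y i - x j) = 1 \<longleftrightarrow> i = j" if "i < 5" "j < 5" for i j
  proof -
    have "quadratic_char (y i - x j) = quadratic_char (x j - y i)"
      using quadratic_char_uminus[of "x j - y i"] by simp
    then show ?thesis using XY[OF that(2,1)] by auto
  qed
  have inj_x: "inj_on x {..<5}"
    using X0 by (intro inj_onI) (metis diff_self lessThan_iff quadratic_char_0)
  have inj_y: "inj_on y {..<5}"
    using X0 yy by (intro inj_onI) (metis diff_self lessThan_iff minus_zero neg_equal_iff_equal quadratic_char_0)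
  have "quadratic_char (x i) = 1" "quadratic_char (y i) = -1" for i
    using r n(1) by (simp_all add: x_def y_def quadratic_char_power quadratic_char_h)
  then have "x i \<noteq> y j" for i j by (metis one_neq_neg_one)
  then have dis: "x ` {..<5} \<inter> y ` {..<5} = {}" by blast
  show "digraph_iso (with_proj paley_graph \<restriction> (R \<union> (*) n ` R)) (with_proj petersen_graph)"
  proof (cases "\<epsilon> = 1")
    case True
    show ?thesis
      unfolding img(2) unfolding img(1)
    proof (rule digraph_iso_petersenI[OF inj_x inj_y dis])
      fix i j :: nat assume ij: "i < 5" "j < 5"
      show "quadratic_char (x i - x j) = 1 \<longleftrightarrow> j = (i + 1) mod 5 \<or> i = (j + 1) mod 5"
        using X1[OF ij] by (simp only: True)
      show "quadratic_char (y i - y j) = 1 \<longleftrightarrow> j = (i + 2) mod 5 \<or> i = (j + 2) mod 5"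
        unfolding yy_iff using X2[OF ij] by (simp only: True)
    qed (rule XY YX; assumption)+
  next
    case False
    then have \<epsilon>': "\<epsilon> = -1" using \<epsilon> by blast
    show ?thesis
      unfolding img(2) unfolding img(1) Un_commute[of "x ` {..<5}"]
    proof (rule digraph_iso_petersenI[OF inj_y inj_x])
      show "y ` {..<5} \<inter> x ` {..<5} = {}" using dis by blast
      fix i j :: nat assume ij: "i < 5" "j < 5"
      show "quadratic_char (y i - y j) = 1 \<longleftrightarrow> j = (i + 1) mod 5 \<or> i = (j + 1) mod 5"
        unfolding yy_iff using X1[OF ij] by (simp only: \<epsilon>')
      show "quadratic_char (x i - x j) = 1 \<longleftrightarrow> j = (i + 2) mod 5 \<or> i = (j + 2) mod 5"
        using X2[OF ij] by (simp only: \<epsilon>' minus_minus)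
    qed (rule XY YX; assumption)+
  qed
qed

end

theorem theorem3p1:
  fixes q :: nat and \<alpha> h :: "'a::finite_field"
  assumes "CARD('a) = q"
    and "primepow q"
    and "[q = 1] (mod 20)"
    and "primitive_element \<alpha>"
    and "h = \<alpha> ^ ((q - 1) div 5)"
  shows "G52_partitionable {1, h, h ^ 2, h ^ 3, h ^ 4} \<longleftrightarrow> quadratic_char (1 + h) = -1"
proof -
  have q: "CARD('a) mod 20 = 1" using assms(1,3) by (simp add: cong_def)
  obtain k where k: "q = 20 * k + 1" "k > 0"
  proof
    show "q = 20 * (q div 20) + 1" using q assms(1) mult_div_mod_eq[of 20 q] by simp
    have "q > 1" using assms(1) card_mono[of "UNIV :: 'a set" "{0, 1}"] by simp
    then show "q div 20 > 0" using q assms(1) by (cases "q div 20 = 0") (auto simp: div_eq_0_iff)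
  qed
  have h: "h = \<alpha> ^ (4 * k)" using assms(5) by (simp add: k(1))
  have \<alpha>0: "\<alpha> \<noteq> 0" using assms(4) by (simp add: primitive_element_def)
  have h5: "h ^ 5 = 1"
    using finite_field_power_order[OF \<alpha>0] assms(1) k(1) by (simp add: h flip: power_mult)
  have h1: "h \<noteq> 1"
    unfolding h by (rule primitive_element_power_ne_1) (use assms(1,4) k in auto)
  interpret odd_field "TYPE('a)" by unfold_locales (use assms(1) k in simp)
  have "(-1::'a) ^ ((CARD('a) - 1) div 2) = 1" using assms(1) k(1) by simp
  then have minus_1: "quadratic_char (-1::'a) = 1"
    using quadratic_char_euler[OF odd_card, of "-1"] by simp
  interpret square_fifth_root "TYPE('a)" h by unfold_locales (fact h5, fact minus_1)
  have "1 + h \<noteq> 0"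
  proof
    assume "1 + h = 0"
    then have "h = -1" by (simp add: add_eq_0_iff)
    then have "h ^ 5 = -1" by simp
    then show False using h5 one_ne_minus_one by simp
  qed
  then have cases: "quadratic_char (1 + h) = 1 \<or> quadratic_char (1 + h) = -1"
    by (rule quadratic_char_cases)
  show ?thesis
  proof
    assume "G52_partitionable {1, h, h ^ 2, h ^ 3, h ^ 4}"
    then show "quadratic_char (1 + h) = -1" using not_partitionable h1 cases by blast
  next
    assume nonsq: "quadratic_char (1 + h) = -1"
    have pp: "primepow CARD('a)" using assms(1,2) by simp
    obtain n where n: "CARD('a) = CHAR('a) ^ n" "odd n" "CHAR('a) mod 20 = 1" "h \<in> prime_subfield"
      using char_of_nonsquare_one_plus_fifth_root[OF pp q h5 h1 nonsq] by blast
    have "odd CHAR('a)" using n(3) mod_mod_cancel[of 2 20 "CHAR('a)"] by (auto simp: odd_iff_mod_2_eq_one)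
    then interpret fr: fifth_root "TYPE('a)" h
      by unfold_locales (use n h5 h1 in auto)
    obtain t where t: "t \<in> prime_subfield" "legendre t = -1" "legendre (1 - t) = 1"
      "\<forall>j\<in>{1..4}. legendre (1 - t * h ^ j) = -1"
      using fr.exists_good_nonresidue by blast
    note leg = fr.quadratic_char_eq_legendre[OF n(1,2)]
    show "G52_partitionable {1, h, h ^ 2, h ^ 3, h ^ 4}"
      by (rule partitionable[OF nonsq, of t]) (use t n(4) in \<open>simp_all add: leg\<close>)
  qed
qed

end
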